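(* Let $Q$ be a Presburger group, let $\{M_n\}_{n\in Z}$ be a constructible family of $Q$-modules over a Rees monoid $G_+$ with $G=Z\times Q$, and fix a monomial ideal $I$ (generated by finitely many monomials) in $R=\Bbbk[Q_+]$. Then for every $i$, the family $\{H^i_I(M_n)\}_{n\in Z}$ of local cohomology modules is constructible over $G_+$.
   Context: $\Bbbk$ is a field. A subset of a finitely generated free abelian group is semisimple if it is a finite disjoint union of sets $q+N$ with $N$ a submonoid generated by linearly independent elements. A Presburger group is a free abelian group $Q$ of finite rank with a semisimple submonoid $Q_+$ (trivial units) generating a finite-index subgroup, ordered by $q\preceq q'$ iff $q'-q\in Q_+$. A $Q$-module is a $Q$-graded $\Bbbk[Q_+]$-module; it is constructible if its graded pieces are finite-dimensional and $Q$ has a partition into finitely many semisimple regions $I$ with vector spaces $M_I$ and isomorphisms $M_I\to M_i$ ($i\in I$) such that for $i\in I$, $j\in J$, $i\preceq j$, the composite $M_I\to M_i\to M_j\to M_J$ depends only on $I,J$. A Rees monoid over $Q$ is the positive cone $G_+$ of a Presburger group $G=Z\times Q$ ($Z$ free abelian of finite rank) with $G_+\cap(\{0\}\times Q)=\{0\}\times Q_+$. A family $\{M_n\}_{n\in Z}$ of $Q$-modules is a $G$-family if $\bigoplus_nM_n(-n)$ (with $M_n$ in slice $\{n\}\times Q$) is a $G$-graded $\Bbbk[G_+]$-module restricting to the given $Q$-module structures on slices; it is constructible over $G_+$ if this $G$-module is constructible. For $I=\langle m_1,\dots,m_r\rangle$ monomial, $H^i_I(M)$ is the $i$-th cohomology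 of $M\otimes_R\check C^\bullet_I$, where $\check C^\bullet_I:0\to R\to\bigoplus_iR[m_i^{-1}]\to\cdots\to R[m_1^{-1}\cdots m_r^{-1}]\to0$ is the Čech complex. *)

theory Defs
  imports Main HOL.Vector_Spaces "HOL-Library.Function_Algebras" "HOL-Library.Product_Plus"
begin

definition nmul :: "nat \<Rightarrow> 'a::ab_group_add \<Rightarrow> 'a" where
  "nmul k x = (((+) x) ^^ k) 0"

definition zmul :: "int \<Rightarrow> 'a::ab_group_add \<Rightarrow> 'a" where
  "zmul c x = (if 0 \<le> c then nmul (nat c) x else - nmul (nat (- c)) x)"

definition is_Zbasis :: "'a::ab_group_add list \<Rightarrow> bool" where
  "is_Zbasis bs \<longleftrightarrow> (\<forall>x. \<exists>!cs::int list. length cs = length bs \<and>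
       x = (\<Sum>j<length bs. zmul (cs ! j) (bs ! j)))"

definition free_fin_rank :: "'a::ab_group_add itself \<Rightarrow> bool" where
  "free_fin_rank _ \<longleftrightarrow> (\<exists>bs::'a list. is_Zbasis bs)"

definition lin_indep :: "'a::ab_group_add list \<Rightarrow> bool" where
  "lin_indep ns \<longleftrightarrow> (\<forall>cs::int list. length cs = length ns \<and>
       (\<Sum>j<length ns. zmul (cs ! j) (ns ! j)) = 0 \<longrightarrow> (\<forall>j<length ns. cs ! j = 0))"

definition monoid_gen :: "'a::ab_group_add list \<Rightarrow> 'a set" where
  "monoid_gen ns = {(\<Sum>j<length ns. nmul (cs ! j) (ns ! j)) | cs::nat list. length cs = length ns}"

definition translate_gen :: "'a::ab_group_add \<times> 'a list \<Rightarrow> 'a set" where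
  "translate_gen p = (\<lambda>n. fst p + n) ` monoid_gen (snd p)"

definition semisimple :: "'a::ab_group_add set \<Rightarrow> bool" where
  "semisimple A \<longleftrightarrow> (\<exists>ps::('a \<times> 'a list) list.
      (\<forall>p\<in>set ps. lin_indep (snd p)) \<and>
      (\<forall>j l. j < length ps \<and> l < length ps \<and> j \<noteq> l \<longrightarrow>
          translate_gen (ps ! j) \<inter> translate_gen (ps ! l) = {}) \<and>
      A = (\<Union>p\<in>set ps. translate_gen p))"

definition presburger :: "'a::ab_group_add set \<Rightarrow> bool" where
  "presburger Qp \<longleftrightarrow> free_fin_rank TYPE('a) \<and> semisimple Qp \<and>
     0 \<in> Qp \<and> (\<forall>a b. a \<in> Qp \<and> b \<in> Qp \<longrightarrow> a + b \<in> Qp) \<and>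
     (\<forall>a. a \<in> Qp \<and> - a \<in> Qp \<longrightarrow> a = 0) \<and>
     (\<exists>T. finite T \<and> (\<forall>x. \<exists>t\<in>T. \<exists>a\<in>Qp. \<exists>b\<in>Qp. x - t = a - b))"

definition rees_monoid :: "'q::ab_group_add set \<Rightarrow> ('z::ab_group_add \<times> 'q) set \<Rightarrow> bool" where
  "rees_monoid Qp Gp \<longleftrightarrow> free_fin_rank TYPE('z) \<and> presburger Gp \<and>
     {g \<in> Gp. fst g = 0} = (\<lambda>q. (0, q)) ` Qp"

text \<open>A G-graded k[G_+]-module: pieces V g (subspaces of an ambient k-vector space),
  and act g g' = multiplication by the monomial x^(g'-g) for g'-g in G_+.\<close>
definition gmodule :: "('k::field \<Rightarrow> 'v::ab_group_add \<Rightarrow> 'v) \<Rightarrow> 'g::ab_group_add set \<Rightarrow>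
     ('g \<Rightarrow> 'v set) \<Rightarrow> ('g \<Rightarrow> 'g \<Rightarrow> 'v \<Rightarrow> 'v) \<Rightarrow> bool" where
  "gmodule sc Gp V act \<longleftrightarrow>
     (\<forall>g. 0 \<in> V g \<and> (\<forall>x\<in>V g. \<forall>y\<in>V g. x + y \<in> V g) \<and> (\<forall>c. \<forall>x\<in>V g. sc c x \<in> V g)) \<and>
     (\<forall>g g'. g' - g \<in> Gp \<longrightarrow>
        (\<forall>x\<in>V g. act g g' x \<in> V g') \<and>
        (\<forall>x\<in>V g. \<forall>y\<in>V g. act g g' (x + y) = act g g' x + act g g' y) \<and>
        (\<forall>c. \<forall>x\<in>V g. act g g' (sc c x) = sc c (act g g' x))) \<and>
     (\<forall>g. \<forall>x\<in>V g. act g g x = x) \<and>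
     (\<forall>g g' g''. g' - g \<in> Gp \<and> g'' - g' \<in> Gp \<longrightarrow>
        (\<forall>x\<in>V g. act g' g'' (act g g' x) = act g g'' x))"

definition lincomb :: "('k \<Rightarrow> 'v::comm_monoid_add \<Rightarrow> 'v) \<Rightarrow> nat \<Rightarrow> (nat \<Rightarrow> 'k) \<Rightarrow> (nat \<Rightarrow> 'v) \<Rightarrow> 'v" where
  "lincomb sc r c z = (\<Sum>s<r. sc (c s) (z s))"

text \<open>Constructibility of a module given as a subquotient Z g / B g with induced maps psi.
  The vector space M_I attached to region number I is k^(r I); the isomorphism
  M_I -> M_i (i in region I) sends the standard basis to the classes of zb I i 0, ..., zb I i (r I - 1);
  the composite M_I -> M_i -> M_j -> M_J is given by the matrix C I J.
  For an honest module take B g = {0}, Z g = V g.\<close>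
definition constructible :: "('k::field \<Rightarrow> 'w::ab_group_add \<Rightarrow> 'w) \<Rightarrow> 'g::ab_group_add set \<Rightarrow>
     ('g \<Rightarrow> 'w set) \<Rightarrow> ('g \<Rightarrow> 'w set) \<Rightarrow> ('g \<Rightarrow> 'g \<Rightarrow> 'w \<Rightarrow> 'w) \<Rightarrow> bool" where
  "constructible sc Gp Z B psi \<longleftrightarrow>
    (\<exists>parts::'g set list. \<exists>r::nat \<Rightarrow> nat. \<exists>zb::nat \<Rightarrow> 'g \<Rightarrow> nat \<Rightarrow> 'w.
     \<exists>C::nat \<Rightarrow> nat \<Rightarrow> nat \<Rightarrow> nat \<Rightarrow> 'k.
      (\<forall>P\<in>set parts. semisimple P) \<and>
      (\<forall>I J. I < length parts \<and> J < length parts \<and> I \<noteq> J \<longrightarrow> parts ! I \<inter> parts ! J = {}) \<and>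
      (\<Union>P\<in>set parts. P) = UNIV \<and>
      (\<forall>I < length parts. \<forall>i \<in> parts ! I.
          (\<forall>s < r I. zb I i s \<in> Z i) \<and>
          (\<forall>c. lincomb sc (r I) c (zb I i) \<in> B i \<longrightarrow> (\<forall>s < r I. c s = 0)) \<and>
          (\<forall>z \<in> Z i. \<exists>c. z - lincomb sc (r I) c (zb I i) \<in> B i)) \<and>
      (\<forall>I < length parts. \<forall>J < length parts. \<forall>i \<in> parts ! I. \<forall>j \<in> parts ! J.
          j - i \<in> Gp \<longrightarrow>
          (\<forall>s < r I. psi i j (zb I i s) - lincomb sc (r J) (\<lambda>t. C I J t s) (zb J j) \<in> B j)))"

definition fsc :: "('k \<Rightarrow> 'v \<Rightarrow> 'v) \<Rightarrow> 'k \<Rightarrow> ('i \<Rightarrow> 'v) \<Rightarrow> ('i \<Rightarrow> 'v)" where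
  "fsc sc c f = (\<lambda>x. sc c (f x))"

definition span_sc :: "('k \<Rightarrow> 'w::ab_group_add \<Rightarrow> 'w) \<Rightarrow> 'w set \<Rightarrow> 'w set" where
  "span_sc sc X = {(\<Sum>x\<in>T. sc (c x) x) | T c. finite T \<and> T \<subseteq> X}"

text \<open>Degree of the monomial m_S = prod_{j in S} m_j, viewed in G = Z x Q (zero Z-component).\<close>
definition degS :: "'q::ab_group_add list \<Rightarrow> nat set \<Rightarrow> ('z::ab_group_add \<times> 'q)" where
  "degS as S = (0, (\<Sum>j\<in>S. as ! j))"

definition cech_valid :: "'q list \<Rightarrow> nat \<Rightarrow> nat set \<Rightarrow> bool" where
  "cech_valid as i S \<longleftrightarrow> S \<subseteq> {..<length as} \<and> card S = i"

text \<open>Degree-g part of the free sum of the i-th Cech term, before passing to colimits: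
  families indexed by (S,k) with |S| = i and entry in N_(g + k deg m_S)
  (representing v / m_S^k).\<close>
definition cechF :: "('z::ab_group_add \<times> 'q::ab_group_add \<Rightarrow> 'v::ab_group_add set) \<Rightarrow> 'q list \<Rightarrow> nat \<Rightarrow>
     'z \<times> 'q \<Rightarrow> (nat set \<times> nat \<Rightarrow> 'v) set" where
  "cechF V as i g = {f. finite {x. f x \<noteq> 0} \<and>
     (\<forall>S k. if cech_valid as i S then f (S, k) \<in> V (g + nmul k (degS as S)) else f (S, k) = 0)}"

definition delta :: "'a \<Rightarrow> 'v::zero \<Rightarrow> ('a \<Rightarrow> 'v)" where
  "delta a v = (\<lambda>x. if x = a then v else 0)"

text \<open>Relations defining the colimits M[m_S^{-1}]_g = colim_k M_(g + k deg m_S).\<close>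
definition cechR :: "('k::field \<Rightarrow> 'v::ab_group_add \<Rightarrow> 'v) \<Rightarrow>
     ('z::ab_group_add \<times> 'q::ab_group_add \<Rightarrow> 'v set) \<Rightarrow>
     ('z \<times> 'q \<Rightarrow> 'z \<times> 'q \<Rightarrow> 'v \<Rightarrow> 'v) \<Rightarrow> 'q list \<Rightarrow> nat \<Rightarrow> 'z \<times> 'q \<Rightarrow> (nat set \<times> nat \<Rightarrow> 'v) set" where
  "cechR sc V act as i g = span_sc (fsc sc)
     {delta (S, k) v - delta (S, Suc k)
        (act (g + nmul k (degS as S)) (g + nmul (Suc k) (degS as S)) v) | S k v.
       cech_valid as i S \<and> v \<in> V (g + nmul k (degS as S))}"

definition cechd :: "('k::field \<Rightarrow> 'v::ab_group_add \<Rightarrow> 'v) \<Rightarrow>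
     ('z::ab_group_add \<times> 'q::ab_group_add \<Rightarrow> 'z \<times> 'q \<Rightarrow> 'v \<Rightarrow> 'v) \<Rightarrow> 'q list \<Rightarrow> nat \<Rightarrow> 'z \<times> 'q \<Rightarrow>
     (nat set \<times> nat \<Rightarrow> 'v) \<Rightarrow> (nat set \<times> nat \<Rightarrow> 'v)" where
  "cechd sc act as i g f = (\<lambda>(T, k).
     if cech_valid as (Suc i) T then
       (\<Sum>j\<in>T. sc ((-1) ^ card {s \<in> T - {j}. s < j})
          (act (g + nmul k (degS as (T - {j}))) (g + nmul k (degS as T)) (f (T - {j}, k))))
     else 0)"

text \<open>Cocycles and coboundaries (both containing the colimit relations) in degree g.\<close>
definition cechZ :: "('k::field \<Rightarrow> 'v::ab_group_add \<Rightarrow> 'v) \<Rightarrow>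
     ('z::ab_group_add \<times> 'q::ab_group_add \<Rightarrow> 'v set) \<Rightarrow>
     ('z \<times> 'q \<Rightarrow> 'z \<times> 'q \<Rightarrow> 'v \<Rightarrow> 'v) \<Rightarrow> 'q list \<Rightarrow> nat \<Rightarrow> 'z \<times> 'q \<Rightarrow> (nat set \<times> nat \<Rightarrow> 'v) set" where
  "cechZ sc V act as i g = {f \<in> cechF V as i g. cechd sc act as i g f \<in> cechR sc V act as (Suc i) g}"

definition cechB :: "('k::field \<Rightarrow> 'v::ab_group_add \<Rightarrow> 'v) \<Rightarrow>
     ('z::ab_group_add \<times> 'q::ab_group_add \<Rightarrow> 'v set) \<Rightarrow>
     ('z \<times> 'q \<Rightarrow> 'z \<times> 'q \<Rightarrow> 'v \<Rightarrow> 'v) \<Rightarrow> 'q list \<Rightarrow> nat \<Rightarrow> 'z \<times> 'q \<Rightarrow> (nat set \<times> nat \<Rightarrow> 'v) set" where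
  "cechB sc V act as i g = {x + y | x y. x \<in> cechR sc V act as i g \<and>
     (case i of 0 \<Rightarrow> y = 0 | Suc i' \<Rightarrow> y \<in> cechd sc act as i' g ` cechF V as i' g)}"

definition cech_act :: "('z::ab_group_add \<times> 'q::ab_group_add \<Rightarrow> 'z \<times> 'q \<Rightarrow> 'v \<Rightarrow> 'v) \<Rightarrow> 'q list \<Rightarrow>
     'z \<times> 'q \<Rightarrow> 'z \<times> 'q \<Rightarrow> (nat set \<times> nat \<Rightarrow> 'v) \<Rightarrow> (nat set \<times> nat \<Rightarrow> 'v)" where
  "cech_act act as g g' f = (\<lambda>(S, k). act (g + nmul k (degS as S)) (g' + nmul k (degS as S)) (f (S, k)))"

end

theory Submission
  imports Defs
begin

text \<open>For a direction \<open>a\<close> in the cone, the points \<open>g + k a\<close> eventually visit the regions of the given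
  partition periodically in \<open>k\<close>, so along multiples of a common period each \<open>g\<close> has one
  eventual region. All maps within a region are isomorphisms, hence the degree \<open>g\<close> part of the
  localization \<open>M[m\<^sub>S\<^sup>-\<^sup>1]\<close> is the vector space of the eventual region of \<open>g\<close> in direction \<open>deg m\<^sub>S\<close>.
  Recording these regions for all \<open>S\<close> at once refines \<open>G\<close> into finitely many pieces on which the
  degree \<open>g\<close> part of the Cech complex is isomorphic to a fixed complex of matrices, with fixed
  matrices between comparable pieces; cohomology inherits this. That the pieces are again
  semisimple is quantifier elimination: semisimple sets are the Boolean combinations of
  half-spaces and congruence conditions.\<close>

section \<open>Semisimple sets\<close>

text \<open>Two features of the definitions shape the proof. First, cohomology is not presented as a
  quotient of colimits: it is \<open>cechZ\<close> modulo \<open>cechB\<close> inside finitely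
  supported families indexed by pairs \<open>(S, k)\<close>, an entry being the numerator over the
  \<open>k\<close>-th power of the monomial of \<open>S\<close>. The link to matrices is one linear
  map, \<open>emap\<close>, which evaluates such a family in every localization. Its kernel on
  cochains is exactly the relation space \<open>cechR\<close>, so cocycles and coboundaries become
  preimages of subspaces of a finite-dimensional space. Second, the given matrices relate regions,
  and only through comparable points. The period \<open>M\<close> is common to all \<open>S\<close>,
  so that for \<open>S \<subseteq> T\<close> and \<open>h - g \<in> Gp\<close> the points reached
  after the same number \<open>l * M\<close> of steps are comparable and, for large
  \<open>l\<close>, lie in their eventual regions; one matrix then serves all such pairs. Two
  descriptions of regions are needed: translated free monoids, as the definition demands, and
  conditions on integer functionals, from which the behaviour along a ray can be read off.\<close>

lemma nmul_0 [simp]: "nmul 0 x = 0"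
  by (simp add: nmul_def)

lemma nmul_Suc [simp]: "nmul (Suc k) x = x + nmul k x"
  by (simp add: nmul_def)

lemma nmul_add: "nmul (j + k) x = nmul j x + nmul k x"
  by (induction j) (auto simp: algebra_simps)

lemma nmul_diff: "j \<le> k \<Longrightarrow> nmul (k - j) x = nmul k x - nmul j x"
  using nmul_add[of "k - j" j x] by simp

lemma nmul_distrib: "nmul k (x + y) = nmul k x + nmul k y"
  by (induction k) (auto simp: algebra_simps)

lemma nmul_zero [simp]: "nmul k 0 = 0"
  by (induction k) auto

lemma nmul_minus: "nmul k (- x) = - nmul k x"
  by (induction k) (auto simp: algebra_simps)

lemma nmul_diff_right: "nmul k (x - y) = nmul k x - nmul k y"
  using nmul_distrib[of k x "- y"] by (simp add: nmul_minus)

lemma nmul_mult: "nmul (j * k) x = nmul j (nmul k x)"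
  by (induction j) (auto simp: nmul_add)

lemma zmul_of_nat [simp]: "zmul (int k) x = nmul k x"
  by (simp add: zmul_def)

text \<open>\<open>zmul\<close> is defined by a sign distinction, but on a difference of naturals it
  has a single formula, and every integer is such a difference. The additivity laws below reduce in
  this way to those of \<open>nmul\<close>.\<close>

lemma zmul_diff_nat: "zmul (int j - int k) x = nmul j x - nmul k x"
proof (cases "k \<le> j")
  case True
  then have "int j - int k = int (j - k)" by simp
  then show ?thesis using True by (simp only: zmul_of_nat nmul_diff)
next
  case False
  then have "int j - int k < 0" "nat (- (int j - int k)) = k - j" by auto
  then show ?thesis using False by (simp add: zmul_def nmul_diff)
qed

lemma int_diff_natE:
  fixes c :: int
  obtains j k where "c = int j - int k"
  by (rule that[of "nat c" "nat (- c)"]) simp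

lemma zmul_0 [simp]: "zmul 0 x = 0"
  by (simp add: zmul_def)

lemma zmul_add: "zmul (a + b) x = zmul a x + zmul b x"
proof -
  obtain j k where a: "a = int j - int k" by (rule int_diff_natE)
  obtain l m where b: "b = int l - int m" by (rule int_diff_natE)
  have "a + b = int (j + l) - int (k + m)" using a b by simp
  then show ?thesis unfolding a b by (simp only: zmul_diff_nat nmul_add) simp
qed

lemma zmul_distrib: "zmul a (x + y) = zmul a x + zmul a y"
proof -
  obtain j k where a: "a = int j - int k" by (rule int_diff_natE)
  show ?thesis unfolding a by (simp add: zmul_diff_nat nmul_distrib)
qed

lemma additive_zmul_left: "additive (\<lambda>a. zmul a x)"
  by standard (rule zmul_add)

lemma additive_zmul_right: "additive (zmul a)"
  by standard (rule zmul_distrib)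

lemmas zmul_minus_left = additive.minus[OF additive_zmul_left]
lemmas zmul_diff_left = additive.diff[OF additive_zmul_left]
lemmas zmul_minus_right = additive.minus[OF additive_zmul_right]
lemmas zmul_sum_right = additive.sum[OF additive_zmul_right]

lemma additive_nmul: "additive f \<Longrightarrow> f (nmul k x) = nmul k (f x)"
  by (induction k) (auto simp: additive.zero additive.add)

lemma additive_zmul: "additive f \<Longrightarrow> f (zmul c x) = zmul c (f x)"
  by (auto simp: zmul_def additive_nmul additive.minus)

lemma nmul_int [simp]: "nmul k (x::int) = int k * x"
  by (induction k) (auto simp: algebra_simps)

lemma zmul_int [simp]: "zmul c (x::int) = c * x"
  by (auto simp: zmul_def)

text \<open>Multiples of \<open>x\<close> form an additive image of the integers, so they commute
  with \<open>zmul a\<close>, and \<open>zmul a b\<close> on the integers themselves is the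
  product.\<close>

lemma zmul_mult: "zmul (a * b) x = zmul a (zmul b x)"
  by (metis additive_zmul[OF additive_zmul_left] zmul_int)

lemma zmul_nmul: "zmul a (nmul n x) = zmul (int n * a) x"
  by (metis zmul_mult mult.commute zmul_of_nat)

definition indep :: "(nat \<Rightarrow> 'a::ab_group_add) \<Rightarrow> nat set \<Rightarrow> bool" where
  "indep ns J \<longleftrightarrow> finite J \<and>
     (\<forall>c::nat \<Rightarrow> int. (\<Sum>j\<in>J. zmul (c j) (ns j)) = 0 \<longrightarrow> (\<forall>j\<in>J. c j = 0))"

definition par :: "(nat \<Rightarrow> 'a::ab_group_add) \<Rightarrow> nat set \<Rightarrow> (nat \<Rightarrow> nat) \<Rightarrow> 'a" where
  "par ns J c = (\<Sum>j\<in>J. nmul (c j) (ns j))"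

definition piece :: "'a::ab_group_add \<Rightarrow> (nat \<Rightarrow> 'a) \<Rightarrow> nat set \<Rightarrow> 'a set" where
  "piece q ns J = range (\<lambda>c. q + par ns J c)"

lemma par_inj:
  assumes "indep ns J" "par ns J c = par ns J c'" "j \<in> J"
  shows "c j = c' j"
proof -
  have "(\<Sum>j\<in>J. zmul (int (c j) - int (c' j)) (ns j)) = 0"
    using assms(2) by (simp add: zmul_diff_nat par_def sum_subtractf)
  moreover have *: "(\<Sum>j\<in>J. zmul (k j) (ns j)) = 0 \<Longrightarrow> k j = 0" for k
    using assms(1,3) unfolding indep_def by blast
  ultimately show ?thesis using *[of "\<lambda>j. int (c j) - int (c' j)"] by simp
qed

lemma par_cong: "(\<And>j. j \<in> J \<Longrightarrow> c j = c' j) \<Longrightarrow> par ns J c = par ns J c'"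
  by (simp add: par_def)

text \<open>Binary disjoint unions replace the pairwise disjoint list in \<open>semisimple\<close>,
  which gives an induction principle; the two notions are shown equivalent below.\<close>

inductive piecewise :: "'a::ab_group_add set \<Rightarrow> bool" where
  piecewise_empty: "piecewise {}"
| piecewise_piece: "indep ns J \<Longrightarrow> piecewise (piece q ns J)"
| piecewise_Un: "piecewise A \<Longrightarrow> piecewise B \<Longrightarrow> A \<inter> B = {} \<Longrightarrow> piecewise (A \<union> B)"

lemma piecewise_UN:
  assumes "finite X" "\<And>x. x \<in> X \<Longrightarrow> piecewise (A x)"
    and "\<And>x y. x \<in> X \<Longrightarrow> y \<in> X \<Longrightarrow> x \<noteq> y \<Longrightarrow> A x \<inter> A y = {}"
  shows "piecewise (\<Union>x\<in>X. A x)"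
  using assms
proof (induction X rule: finite_induct)
  case empty
  then show ?case by (simp add: piecewise_empty)
next
  case (insert x X)
  have "A x \<inter> (\<Union>x\<in>X. A x) = {}"
    using insert.prems(2)[of x] insert.hyps by auto
  then show ?case using insert by (auto intro!: piecewise_Un)
qed

lemma piece_list:
  "translate_gen (q, ns) = piece q ((!) ns) {..<length ns}"
proof -
  have "par ((!) ns) {..<length ns} c \<in> monoid_gen ns" for c
    unfolding monoid_gen_def par_def by (auto intro!: exI[of _ "map c [0..<length ns]"] sum.cong)
  then have "monoid_gen ns = range (par ((!) ns) {..<length ns})"
    unfolding monoid_gen_def par_def by auto
  then show ?thesis unfolding translate_gen_def piece_def by auto
qed

lemma indep_list: "lin_indep ns \<longleftrightarrow> indep ((!) ns) {..<length ns}"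
proof -
  show ?thesis
  proof
    assume l: "lin_indep ns"
    show "indep ((!) ns) {..<length ns}"
      unfolding indep_def
    proof (intro conjI allI impI ballI)
      fix c :: "nat \<Rightarrow> int" and j
      assume c: "(\<Sum>j<length ns. zmul (c j) (ns ! j)) = 0" and j: "j \<in> {..<length ns}"
      have "(\<Sum>j<length ns. zmul (map c [0..<length ns] ! j) (ns ! j)) = (\<Sum>j<length ns. zmul (c j) (ns ! j))"
        by (rule sum.cong) auto
      then have "map c [0..<length ns] ! j = 0"
        using l[unfolded lin_indep_def, rule_format, of "map c [0..<length ns]" j] c j by simp
      then show "c j = 0" using j by simp
    qed simp
  next
    assume "indep ((!) ns) {..<length ns}"
    then show "lin_indep ns"
      unfolding indep_def lin_indep_def by auto
  qed
qed

text \<open>Carries an arbitrary finite index set to an initial segment of the naturals, the form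
  needed for passing back to lists of generators.\<close>

lemma piece_reindex:
  assumes "bij_betw h J J'"
  shows "piece q ns J' = piece q (ns \<circ> h) J"
proof -
  have 1: "par ns J' c = par (ns \<circ> h) J (c \<circ> h)" for c
    unfolding par_def using sum.reindex_bij_betw[OF assms, of "\<lambda>j. nmul (c j) (ns j)"] by simp
  have 2: "par (ns \<circ> h) J c = par ns J' (c \<circ> inv_into J h)" for c
    unfolding 1 by (rule par_cong) (use assms in \<open>auto simp: bij_betw_def\<close>)
  have "range (par ns J') = range (par (ns \<circ> h) J)"
    by (intro equalityI image_subsetI) (metis 1 rangeI, metis 2 rangeI)
  then show ?thesis unfolding piece_def image_image[symmetric] by metis
qed

lemma indep_reindex:
  assumes "bij_betw h J J'" "indep ns J'"
  shows "indep (ns \<circ> h) J"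
  unfolding indep_def
proof (intro conjI allI impI ballI)
  show "finite J" using assms bij_betw_finite indep_def by blast
  fix c :: "nat \<Rightarrow> int" and j
  assume c: "(\<Sum>j\<in>J. zmul (c j) ((ns \<circ> h) j)) = 0" and j: "j \<in> J"
  have "(\<Sum>j\<in>J'. zmul ((c \<circ> inv_into J h) j) (ns j)) = (\<Sum>j\<in>J. zmul (c j) ((ns \<circ> h) j))"
    unfolding sum.reindex_bij_betw[OF assms(1), symmetric]
    by (rule sum.cong) (use assms(1) in \<open>auto simp: bij_betw_def\<close>)
  then have "(c \<circ> inv_into J h) (h j) = 0"
    using c assms j unfolding indep_def bij_betw_def by (metis imageI)
  then show "c j = 0" using j assms(1) by (auto simp: bij_betw_def)
qed

lemma piecewise_imp_semisimple: "piecewise A \<Longrightarrow> semisimple A"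
proof (induction rule: piecewise.induct)
  case piecewise_empty
  then show ?case unfolding semisimple_def by (intro exI[of _ "[]"]) simp
next
  case (piecewise_piece ns J q)
  then obtain h where h: "bij_betw h {..<card J} J"
    by (metis indep_def ex_bij_betw_nat_finite lessThan_atLeast0)
  let ?l = "map (ns \<circ> h) [0..<card J]"
  have "piece q (ns \<circ> h) {..<card J} = piece q ((!) ?l) {..<length ?l}"
    unfolding piece_def par_def by auto
  moreover have "indep ((!) ?l) {..<length ?l}"
    using indep_reindex[OF h piecewise_piece] unfolding indep_def by auto
  ultimately show ?case
    unfolding semisimple_def
    by (intro exI[of _ "[(q, ?l)]"]) (auto simp: indep_list piece_list piece_reindex[OF h])
next
  case (piecewise_Un A B)
  obtain ps where ps: "\<forall>p\<in>set ps. lin_indep (snd p)"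
      "\<forall>j l. j < length ps \<and> l < length ps \<and> j \<noteq> l \<longrightarrow> translate_gen (ps ! j) \<inter> translate_gen (ps ! l) = {}"
      "A = (\<Union>p\<in>set ps. translate_gen p)"
    using piecewise_Un(4) unfolding semisimple_def by blast
  obtain rs where rs: "\<forall>p\<in>set rs. lin_indep (snd p)"
      "\<forall>j l. j < length rs \<and> l < length rs \<and> j \<noteq> l \<longrightarrow> translate_gen (rs ! j) \<inter> translate_gen (rs ! l) = {}"
      "B = (\<Union>p\<in>set rs. translate_gen p)"
    using piecewise_Un(5) unfolding semisimple_def by blast
  have AB: "translate_gen (ps ! j) \<inter> translate_gen (rs ! l) = {}" if "j < length ps" "l < length rs" for j l
    using that piecewise_Un(3) ps(3) rs(3) by (meson UN_I disjoint_iff nth_mem)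
  have "translate_gen ((ps @ rs) ! j) \<inter> translate_gen ((ps @ rs) ! l) = {}"
    if "j < length (ps @ rs)" "l < length (ps @ rs)" "j \<noteq> l" for j l
  proof -
    consider "j < length ps" "l < length ps" | "j < length ps" "\<not> l < length ps"
      | "\<not> j < length ps" "l < length ps" | "\<not> j < length ps" "\<not> l < length ps" by blast
    then show ?thesis
    proof cases
      case 1 then show ?thesis using ps(2) that by (simp add: nth_append)
    next
      case 2 then show ?thesis using AB[of j "l - length ps"] that by (simp add: nth_append)
    next
      case 3 then show ?thesis using AB[of l "j - length ps"] that by (simp add: nth_append Int_commute)
    next
      case 4 
      then have "j - length ps < length rs \<and> l - length ps < length rs \<and> j - length ps \<noteq> l - length ps"
        using that by auto
      then show ?thesis using rs(2) 4 by (simp add: nth_append)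
    qed
  qed
  then show ?case unfolding semisimple_def
    by (intro exI[of _ "ps @ rs"]) (use ps rs in auto)
qed

lemma semisimple_imp_piecewise:
  assumes "semisimple A" shows "piecewise A"
proof -
  obtain ps where ps: "\<forall>p\<in>set ps. lin_indep (snd p)"
      "\<forall>j l. j < length ps \<and> l < length ps \<and> j \<noteq> l \<longrightarrow> translate_gen (ps ! j) \<inter> translate_gen (ps ! l) = {}"
      "A = (\<Union>p\<in>set ps. translate_gen p)"
    using assms unfolding semisimple_def by blast
  have "A = (\<Union>j<length ps. translate_gen (ps ! j))"
    unfolding ps(3) by (metis image_image map_nth set_map set_upt lessThan_atLeast0)
  moreover have "piecewise (translate_gen (ps ! j))" if "j < length ps" for j
    using ps(1) that piece_list[of "fst (ps ! j)" "snd (ps ! j)"]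
    by (auto simp: indep_list intro: piecewise_piece)
  ultimately show ?thesis using ps(2) by (auto intro!: piecewise_UN)
qed

lemma pieceI: "q + par ns J c \<in> piece q ns J"
  by (simp add: piece_def)

lemma pieceE:
  assumes "x \<in> piece q ns J"
  obtains c where "x = q + par ns J c"
  using assms by (auto simp: piece_def)

section \<open>Splitting by half-spaces and congruences\<close>

lemma par_add: "par ns J (\<lambda>j. c j + c' j) = par ns J c + par ns J c'"
  by (simp add: par_def nmul_add sum.distrib)

lemma par_single: "finite J \<Longrightarrow> j \<in> J \<Longrightarrow> par ns J (\<lambda>i. if i = j then k else 0) = nmul k (ns j)"
proof -
  assume "finite J" "j \<in> J"
  then have "par ns J (\<lambda>i. if i = j then k else 0) = (\<Sum>i\<in>J. if i = j then nmul k (ns j) else 0)"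
    unfolding par_def by (intro sum.cong) auto
  then show ?thesis using \<open>finite J\<close> \<open>j \<in> J\<close> by simp
qed

lemma par_upd:
  assumes "finite J" "u \<in> J" "v \<in> J" "u \<noteq> v"
  shows "par (ns(u := nmul a (ns u) + nmul b (ns v))) J c =
    par ns J (\<lambda>j. if j = u then a * c u else if j = v then b * c u + c v else c j)"
proof -
  have J: "J = insert u (insert v (J - {u, v}))" using assms by auto
  show ?thesis unfolding par_def
    by (subst (1 2) J, use assms in \<open>simp add: nmul_distrib nmul_add nmul_mult mult.commute[of _ "c u"]\<close>)
qed

text \<open>The substitution of coefficients is triangular with diagonal entries \<open>a\<close>
  and 1, so a relation among the new generators is trivial as soon as the resulting relation among
  the old ones is.\<close>

lemma indep_upd:
  assumes "indep ns J" "u \<in> J" "v \<in> J" "u \<noteq> v" "a > 0"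
  shows "indep (ns(u := nmul a (ns u) + nmul b (ns v))) J"
  unfolding indep_def
proof (intro conjI allI impI ballI)
  show fin: "finite J" using assms by (simp add: indep_def)
  fix c :: "nat \<Rightarrow> int" and j
  assume 0: "(\<Sum>j\<in>J. zmul (c j) ((ns(u := nmul a (ns u) + nmul b (ns v))) j)) = 0" and j: "j \<in> J"
  define c' where "c' = (\<lambda>j. if j = u then int a * c u else if j = v then int b * c u + c v else c j)"
  have J: "J = insert u (insert v (J - {u, v}))" using assms by auto
  have "(\<Sum>j\<in>J. zmul (c j) ((ns(u := nmul a (ns u) + nmul b (ns v))) j)) = (\<Sum>j\<in>J. zmul (c' j) (ns j))"
    unfolding c'_def by (subst (1 2) J, use fin assms in \<open>simp add: zmul_distrib zmul_add zmul_nmul\<close>)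
  then have c': "c' j = 0" if "j \<in> J" for j
    using 0 assms(1) that unfolding indep_def by metis
  have "c u = 0" using c'[OF assms(2)] assms(5) by (simp add: c'_def)
  then show "c j = 0" using c'[OF j] assms(4) by (auto simp: c'_def split: if_splits)
qed

lemma indep_subset:
  assumes "indep ns J" "J' \<subseteq> J"
  shows "indep ns J'"
  unfolding indep_def
proof (intro conjI allI impI ballI)
  show fin: "finite J'" using assms finite_subset by (auto simp: indep_def)
  fix c :: "nat \<Rightarrow> int" and j
  assume 0: "(\<Sum>j\<in>J'. zmul (c j) (ns j)) = 0" and j: "j \<in> J'"
  have "(\<Sum>j\<in>J. zmul ((\<lambda>j. if j \<in> J' then c j else 0) j) (ns j)) = (\<Sum>j\<in>J'. zmul (c j) (ns j))"
    by (rule sum.mono_neutral_cong_right) (use assms in \<open>auto simp: indep_def\<close>)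
  with 0 have "(\<Sum>j\<in>J. zmul ((\<lambda>j. if j \<in> J' then c j else 0) j) (ns j)) = 0" by simp
  moreover have *: "(\<Sum>j\<in>J. zmul (k j) (ns j)) = 0 \<Longrightarrow> k j = 0" for k
    using assms j unfolding indep_def by blast
  ultimately show "c j = 0" using j *[of "\<lambda>j. if j \<in> J' then c j else 0"] by simp
qed

lemma indep_scale:
  assumes "indep ns J" "u \<in> J" "m > 0"
  shows "indep (ns(u := nmul m (ns u))) J"
  unfolding indep_def
proof (intro conjI allI impI ballI)
  show fin: "finite J" using assms by (simp add: indep_def)
  fix c :: "nat \<Rightarrow> int" and j
  assume 0: "(\<Sum>j\<in>J. zmul (c j) ((ns(u := nmul m (ns u))) j)) = 0" and j: "j \<in> J"
  have "(\<Sum>j\<in>J. zmul (c j) ((ns(u := nmul m (ns u))) j)) = (\<Sum>j\<in>J. zmul ((c(u := int m * c u)) j) (ns j))"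
    by (rule sum.cong) (auto simp: zmul_nmul)
  then have "(c(u := int m * c u)) j = 0"
    using 0 assms(1) j unfolding indep_def by metis
  then show "c j = 0" using assms(3) by (auto split: if_splits)
qed

lemma par_scale:
  "par (ns(u := nmul m (ns u))) J c = par ns J (c(u := c u * m))"
  unfolding par_def by (rule sum.cong) (auto simp: nmul_mult)

text \<open>Independence makes coefficients on \<open>J\<close> unique, so disjointness may be
  checked on coefficient vectors.\<close>

lemma params_disjoint:
  assumes "indep ns J" "\<And>c c'. c \<in> A \<Longrightarrow> c' \<in> B \<Longrightarrow> \<exists>j\<in>J. c j \<noteq> c' j"
  shows "(\<lambda>c. q + par ns J c) ` A \<inter> (\<lambda>c. q + par ns J c) ` B = {}"
proof (rule ccontr)
  assume "\<not> ?thesis"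
  then obtain c c' where c: "c \<in> A" "c' \<in> B" "q + par ns J c = q + par ns J c'" by blast
  then have "par ns J c = par ns J c'" by simp
  then show False using assms(2)[OF c(1,2)] par_inj[OF assms(1)] by blast
qed

text \<open>Keeping both halves makes the notion symmetric under complement of \<open>D\<close> and
  additive over disjoint unions of \<open>A\<close>, so that atomic conditions need to be treated on
  single pieces only.\<close>

definition splits :: "'a::ab_group_add set \<Rightarrow> 'a set \<Rightarrow> bool" where
  "splits D A \<longleftrightarrow> piecewise (A \<inter> D) \<and> piecewise (A - D)"

lemma splits_UN:
  assumes "finite X" "\<And>x. x \<in> X \<Longrightarrow> splits D (A x)"
    and "\<And>x y. x \<in> X \<Longrightarrow> y \<in> X \<Longrightarrow> x \<noteq> y \<Longrightarrow> A x \<inter> A y = {}"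
  shows "splits D (\<Union>x\<in>X. A x)"
proof -
  have "piecewise (\<Union>x\<in>X. A x \<inter> D)" "piecewise (\<Union>x\<in>X. A x - D)"
    by (intro piecewise_UN; use assms in \<open>auto simp: splits_def\<close>)+
  moreover have "(\<Union>x\<in>X. A x \<inter> D) = (\<Union>x\<in>X. A x) \<inter> D" "(\<Union>x\<in>X. A x - D) = (\<Union>x\<in>X. A x) - D" by auto
  ultimately show ?thesis unfolding splits_def by simp
qed

lemma splits_Un: "splits D A \<Longrightarrow> splits D B \<Longrightarrow> A \<inter> B = {} \<Longrightarrow> splits D (A \<union> B)"
  unfolding splits_def Int_Un_distrib2 Un_Diff by (intro conjI piecewise_Un) auto

lemma splits_const:
  assumes "piecewise A" "A \<subseteq> D \<or> A \<inter> D = {}"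
  shows "splits D A"
  using assms(2)
proof
  assume "A \<subseteq> D"
  then have "A \<inter> D = A" "A - D = {}" by auto
  then show ?thesis using assms(1) piecewise_empty unfolding splits_def by metis
next
  assume "A \<inter> D = {}"
  then have "A \<inter> D = {}" "A - D = A" by auto
  then show ?thesis using assms(1) piecewise_empty unfolding splits_def by metis
qed

lemma splits_compl: "splits (- D) A \<longleftrightarrow> splits D A"
  by (auto simp: splits_def Diff_eq)

text \<open>The coefficient of generator \<open>j\<close> is either zero, which drops the generator,
  or positive, which moves the base point one step.\<close>

lemma piece_split_generator:
  assumes "indep ns J" "j \<in> J"
  shows "piece q ns J = piece q ns (J - {j}) \<union> piece (q + ns j) ns J"
    and "piece q ns (J - {j}) \<inter> piece (q + ns j) ns J = {}"
proof -
  have fin: "finite J" using assms by (simp add: indep_def)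
  have 0: "par ns (J - {j}) c = par ns J (c(j := 0))" for c
    unfolding par_def by (rule sum.mono_neutral_cong_left) (use fin in auto)
  have s: "ns j + par ns J c = par ns J (c(j := Suc (c j)))" for c
  proof -
    have "par ns J (\<lambda>i. (if i = j then 1 else 0) + c i) = par ns J (c(j := Suc (c j)))"
      by (rule par_cong) auto
    then show ?thesis by (subst (asm) par_add) (simp add: par_single[OF fin assms(2)])
  qed
  let ?P = "\<lambda>A. (\<lambda>c. q + par ns J c) ` A"
  have l: "piece q ns (J - {j}) = ?P {c. c j = 0}"
  proof -
    have "?P {c. c j = 0} \<subseteq> piece q ns (J - {j})"
    proof
      fix x assume "x \<in> ?P {c. c j = 0}"
      then obtain c where c: "c j = 0" "x = q + par ns J c" by auto
      then have "x = q + par ns (J - {j}) c"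
        unfolding 0 by (metis fun_upd_triv)
      then show "x \<in> piece q ns (J - {j})" using pieceI by metis
    qed
    moreover have "piece q ns (J - {j}) \<subseteq> ?P {c. c j = 0}"
    proof
      fix x assume "x \<in> piece q ns (J - {j})"
      then obtain c where "x = q + par ns (J - {j}) c" by (rule pieceE)
      then have "x = q + par ns J (c(j := 0))" by (simp only: 0)
      then show "x \<in> ?P {c. c j = 0}" by (intro image_eqI[of _ _ "c(j := 0)"]) simp_all
    qed
    ultimately show ?thesis by (rule equalityI[rotated])
  qed
  have r: "piece (q + ns j) ns J = ?P {c. c j \<noteq> 0}"
  proof (intro equalityI subsetI)
    fix x assume "x \<in> piece (q + ns j) ns J"
    then obtain c where "x = q + ns j + par ns J c" by (rule pieceE)
    then have "x = q + par ns J (c(j := Suc (c j)))" by (simp only: add.assoc s)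
    then show "x \<in> ?P {c. c j \<noteq> 0}" by (intro image_eqI[of _ _ "c(j := Suc (c j))"]) simp_all
  next
    fix x assume "x \<in> ?P {c. c j \<noteq> 0}"
    then obtain c where c: "c j \<noteq> 0" "x = q + par ns J c" by auto
    have "(c(j := c j - 1))(j := Suc ((c(j := c j - 1)) j)) = c" using c(1) by auto
    then have "q + ns j + par ns J (c(j := c j - 1)) = x"
      by (simp only: s add.assoc c(2))
    then show "x \<in> piece (q + ns j) ns J" using pieceI by metis
  qed
  have "UNIV = {c. c j = (0::nat)} \<union> {c. c j \<noteq> 0}" by auto
  then show "piece q ns J = piece q ns (J - {j}) \<union> piece (q + ns j) ns J"
    unfolding l r image_Un[symmetric] by (metis piece_def)
  show "piece q ns (J - {j}) \<inter> piece (q + ns j) ns J = {}"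
    unfolding l r using assms(2) by (intro params_disjoint[OF assms(1)] bexI[of _ j]) auto
qed

lemma add_par:
  assumes "additive f"
  shows "f (q + par ns J c) = (f q + (\<Sum>j\<in>J. int (c j) * f (ns j)) :: int)"
  by (simp add: par_def additive.add[OF assms] additive.sum[OF assms] additive_nmul[OF assms])

text \<open>With no generator decreasing \<open>f\<close>, the only obstruction is a base point
  below the threshold. Splitting along a generator with \<open>f > 0\<close> either loses that
  generator or lowers the deficit \<open>b - f q\<close>; the induction measure adds the two
  quantities.\<close>

lemma splits_half_same_sign:
  assumes "additive f" "indep ns J" "\<forall>j\<in>J. f (ns j) \<ge> (0::int)"
  shows "splits {x. f x \<ge> b} (piece q ns J)"
  using assms(2,3)
proof (induction "card J + nat (b - f q)" arbitrary: q J rule: less_induct)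
  case less
  have fin: "finite J" using less.prems by (simp add: indep_def)
  consider "f q \<ge> b" | "f q < b" "\<forall>j\<in>J. f (ns j) = 0" | j where "f q < b" "j \<in> J" "f (ns j) > 0"
    using less.prems(2) by force
  then show ?case
  proof cases
    case 1
    have "piece q ns J \<subseteq> {x. f x \<ge> b}"
      using 1 less.prems(2) by (auto simp: piece_def add_par[OF assms(1)] intro!: add_increasing2 sum_nonneg)
    then show ?thesis using less.prems by (intro splits_const piecewise_piece) auto
  next
    case 2
    then have "piece q ns J \<inter> {x. f x \<ge> b} = {}"
      by (auto simp: piece_def add_par[OF assms(1)])
    then show ?thesis using less.prems by (intro splits_const piecewise_piece) auto
  next
    case 3
    have "card (J - {j}) < card J" using fin 3 by (metis card_Diff1_less)
    then have "splits {x. f x \<ge> b} (piece q ns (J - {j}))"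
      using less.prems by (intro less.hyps) (auto intro: indep_subset)
    moreover have "splits {x. f x \<ge> b} (piece (q + ns j) ns J)"
      using less.prems 3 by (intro less.hyps) (auto simp: additive.add[OF assms(1)])
    ultimately show ?thesis
      using piece_split_generator[OF less.prems(1) 3(2), of q] splits_Un by metis
  qed
qed

text \<open>A pair of generators on opposite sides of the hyperplane \<open>f = 0\<close> spans a quadrant, which the
  ray through \<open>w = a u + b v\<close> cuts in two; lattice translates account for \<open>w\<close> not being part of a
  basis of the quadrant.\<close>

lemma piece_split_pair:
  fixes ns :: "nat \<Rightarrow> 'a::ab_group_add"
  assumes "indep ns J" "u \<in> J" "v \<in> J" "u \<noteq> v" "a > 0" "b > 0"
  defines "w \<equiv> nmul a (ns u) + nmul b (ns v)"
  assumes "\<And>e. splits D (piece (q + nmul e (ns u)) (ns(u := w)) J)"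
    and "\<And>e. splits D (piece (q + nmul a (ns u) + nmul e (ns v)) (ns(v := w)) J)"
  shows "splits D (piece q ns J)"
proof -
  have fin: "finite J" using assms by (simp add: indep_def)
  let ?P = "\<lambda>A. (\<lambda>c. q + par ns J c) ` A"
  \<comment> \<open>The quotients say how many copies of \<open>w\<close> the coefficients of
    \<open>u\<close> and of \<open>v\<close> allow. The smaller one becomes the coefficient of
    \<open>w\<close>, and the remainder \<open>e\<close> on that side selects the translate.\<close>
  let ?A1 = "\<lambda>e. {c. c u div a \<le> c v div b \<and> c u mod a = e}"
  let ?A2 = "\<lambda>e. {c. c u div a > c v div b \<and> c v mod b = e}"
  have disjP: "?P A \<inter> ?P B = {}" if "\<And>c c'. c \<in> A \<Longrightarrow> c' \<in> B \<Longrightarrow> c u \<noteq> c' u \<or> c v \<noteq> c' v" for A B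
    using that assms(2,3) by (intro params_disjoint[OF assms(1)]) blast
  have 1: "piece (q + nmul e (ns u)) (ns(u := w)) J = ?P (?A1 e)" if e: "e < a" for e
  proof -
    have *: "q + nmul e (ns u) + par (ns(u := w)) J c =
        q + par ns J (\<lambda>j. if j = u then a * c u + e else if j = v then b * c u + c v else c j)" for c
    proof -
      have "par ns J (\<lambda>j. if j = u then a * c u + e else if j = v then b * c u + c v else c j) =
        par ns J (\<lambda>i. (if i = u then e else 0) + (if i = u then a * c u else if i = v then b * c u + c v else c i))"
        by (rule par_cong) (use assms in auto)
      then show ?thesis
        unfolding w_def par_upd[OF fin assms(2-4)] by (subst (asm) par_add) (simp add: par_single[OF fin assms(2)] algebra_simps)
    qed
    show ?thesis
    proof (intro equalityI subsetI)
      fix x assume "x \<in> piece (q + nmul e (ns u)) (ns(u := w)) J"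
      then obtain c where x: "x = q + par ns J (\<lambda>j. if j = u then a * c u + e else if j = v then b * c u + c v else c j)"
        unfolding piece_def using * by auto
      show "x \<in> ?P (?A1 e)" unfolding x
        by (rule imageI) (use e assms(4-6) in \<open>auto simp: div_add1_eq\<close>)
    next
      fix x assume "x \<in> ?P (?A1 e)"
      then obtain c where c: "c u div a \<le> c v div b" "c u mod a = e" and x: "x = q + par ns J c" by auto
      let ?c = "c(u := c u div a, v := c v - b * (c u div a))"
      have "b * (c u div a) \<le> c v"
        using c(1) by (metis div_times_less_eq_dividend le_trans mult.commute mult_le_mono2)
      then have "q + nmul e (ns u) + par (ns(u := w)) J ?c = x"
        unfolding * x using c assms(4) by (intro arg_cong2[of _ _ _ _ "(+)"] par_cong) auto
      then show "x \<in> piece (q + nmul e (ns u)) (ns(u := w)) J" unfolding piece_def by blast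
    qed
  qed
  \<comment> \<open>The strict inequality leaves at least one block of \<open>a\<close> copies of
    \<open>u\<close> beyond those used up by \<open>w\<close>. This block moves into the base point,
    hence the offset \<open>nmul a (ns u)\<close>; it keeps the two halves from sharing the ray of
    \<open>w\<close>.\<close>
  have 2: "piece (q + nmul a (ns u) + nmul e (ns v)) (ns(v := w)) J = ?P (?A2 e)" if e: "e < b" for e
  proof -
    have *: "q + nmul a (ns u) + nmul e (ns v) + par (ns(v := w)) J c =
        q + par ns J (\<lambda>j. if j = v then b * c v + e else if j = u then a * c v + c u + a else c j)" for c
    proof -
      have w: "w = nmul b (ns v) + nmul a (ns u)" by (simp add: w_def add.commute)
      have "par ns J (\<lambda>j. if j = v then b * c v + e else if j = u then a * c v + c u + a else c j) =
        par ns J (\<lambda>i. (if i = v then e else 0) + ((if i = u then a else 0) + (if i = v then b * c v else if i = u then a * c v + c u else c i)))"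
        by (rule par_cong) (use assms in auto)
      then show ?thesis
        unfolding w par_upd[OF fin assms(3,2) assms(4)[symmetric]] by (subst (asm) par_add, subst (asm) par_add)
          (simp add: par_single[OF fin assms(2)] par_single[OF fin assms(3)] algebra_simps)
    qed
    show ?thesis
    proof (intro equalityI subsetI)
      fix x assume "x \<in> piece (q + nmul a (ns u) + nmul e (ns v)) (ns(v := w)) J"
      then obtain c where x: "x = q + par ns J (\<lambda>j. if j = v then b * c v + e else if j = u then a * c v + c u + a else c j)"
        unfolding piece_def using * by auto
      have "c v < (a * c v + c u + a) div a"
        using assms(5) by (simp add: div_add1_eq) 
      then show "x \<in> ?P (?A2 e)" unfolding x
        by (intro imageI) (use e assms(4-6) in auto)
    next
      fix x assume "x \<in> ?P (?A2 e)"
      then obtain c where c: "c v div b < c u div a" "c v mod b = e" and x: "x = q + par ns J c" by auto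
      let ?c = "c(v := c v div b, u := c u - a * (c v div b) - a)"
      have "a * Suc (c v div b) \<le> c u"
        using c(1) by (metis Suc_leI div_times_less_eq_dividend le_trans mult.commute mult_le_mono2)
      then have "q + nmul a (ns u) + nmul e (ns v) + par (ns(v := w)) J ?c = x"
        unfolding * x using c assms(4) by (intro arg_cong2[of _ _ _ _ "(+)"] par_cong) auto
      then show "x \<in> piece (q + nmul a (ns u) + nmul e (ns v)) (ns(v := w)) J" unfolding piece_def by blast
    qed
  qed
  have "splits D (\<Union>e<a. ?P (?A1 e))"
    by (intro splits_UN disjP) (auto simp: 1[symmetric] assms(8))
  moreover have "splits D (\<Union>e<b. ?P (?A2 e))"
    by (intro splits_UN disjP) (auto simp: 2[symmetric] assms(9))
  moreover have "(\<Union>e<a. ?P (?A1 e)) = ?P {c. c u div a \<le> c v div b}" "(\<Union>e<b. ?P (?A2 e)) = ?P {c. c u div a > c v div b}"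
    unfolding image_UN[symmetric] using assms(5,6) by (intro arg_cong[of _ _ ?P]; auto)+
  moreover have "?P {c. c u div a \<le> c v div b} \<inter> ?P {c. c u div a > c v div b} = {}"
    by (rule disjP) auto
  ultimately have "splits D (?P {c. c u div a \<le> c v div b} \<union> ?P {c. c u div a > c v div b})"
    by (simp add: splits_Un)
  moreover have "?P {c. c u div a \<le> c v div b} \<union> ?P {c. c u div a > c v div b} = piece q ns J"
    unfolding piece_def image_Un[symmetric] by (rule arg_cong[of _ _ ?P]) auto
  ultimately show ?thesis by simp
qed

text \<open>Two generators with opposite signs are combined into \<open>w\<close> with weights
  chosen so that \<open>f w = 0\<close>. Replacing either of them by \<open>w\<close> lowers the
  number of generators on which \<open>f\<close> is nonzero, until all signs agree.\<close>

lemma splits_half: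
  assumes "additive f" "indep ns J"
  shows "splits {x. f x \<ge> (b::int)} (piece q ns J)"
  using assms(2)
proof (induction "card {j \<in> J. f (ns j) \<noteq> 0}" arbitrary: q ns rule: less_induct)
  case less
  have fin: "finite J" using less.prems by (simp add: indep_def)
  consider "\<forall>j\<in>J. f (ns j) \<ge> 0" | "\<forall>j\<in>J. f (ns j) \<le> 0" | u v where "u \<in> J" "v \<in> J" "f (ns u) > 0" "f (ns v) < 0"
    by (meson not_le)
  then show ?case
  proof cases
    case 1
    then show ?thesis using splits_half_same_sign assms(1) less.prems by blast
  next
    case 2
    \<comment> \<open>Over the integers \<open>f x \<ge> b\<close> is the negation of
      \<open>- f x \<ge> 1 - b\<close>, so the nonpositive case is a complement of the nonnegative
      one.\<close>
    have "additive (\<lambda>x. - f x)" by standard (simp add: additive.add[OF assms(1)])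
    from splits_half_same_sign[OF this less.prems, of "1 - b"] 2
    have "splits (- {x. - f x \<ge> 1 - b}) (piece q ns J)" by (simp add: splits_compl)
    moreover have "- {x. - f x \<ge> 1 - b} = {x. f x \<ge> b}" by auto
    ultimately show ?thesis by simp
  next
    case 3
    define w where "w = nmul (nat (- f (ns v))) (ns u) + nmul (nat (f (ns u))) (ns v)"
    have w': "w = nmul (nat (f (ns u))) (ns v) + nmul (nat (- f (ns v))) (ns u)"
      by (simp add: w_def add.commute)
    have uv: "u \<noteq> v" using 3 by auto
    have fw: "f w = 0" using 3 by (simp add: w_def additive.add[OF assms(1)] additive_nmul[OF assms(1)] algebra_simps)
    have less_card: "card {j \<in> J. f ((ns(j0 := w)) j) \<noteq> 0} < card {j \<in> J. f (ns j) \<noteq> 0}"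
      if "j0 \<in> J" "f (ns j0) \<noteq> 0" for j0
      by (rule psubset_card_mono) (use fin that fw in auto)
    have ind: "indep (ns(u := w)) J" "indep (ns(v := w)) J"
      using indep_upd[OF less.prems 3(1,2) uv, of "nat (- f (ns v))"]
        indep_upd[OF less.prems 3(2,1) uv[symmetric], of "nat (f (ns u))"] 3
      by (auto simp: w_def) (simp add: w_def[symmetric] w')
    show ?thesis
    proof (rule piece_split_pair[OF less.prems 3(1,2) uv, of "nat (- f (ns v))" "nat (f (ns u))"])
      show "nat (- f (ns v)) > 0" "nat (f (ns u)) > 0" using 3 by auto
    next
      show "splits {x. f x \<ge> b} (piece (q + nmul e (ns u))
          (ns(u := nmul (nat (- f (ns v))) (ns u) + nmul (nat (f (ns u))) (ns v))) J)" for e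
        using less_card[of u] ind 3 unfolding w_def[symmetric] by (intro less.hyps) auto
    next
      show "splits {x. f x \<ge> b} (piece (q + nmul (nat (- f (ns v))) (ns u) + nmul e (ns v))
          (ns(v := nmul (nat (- f (ns v))) (ns u) + nmul (nat (f (ns u))) (ns v))) J)" for e
        using less_card[of v] ind 3 unfolding w_def[symmetric] by (intro less.hyps) auto
    qed
  qed
qed

text \<open>Sorting by the residue modulo \<open>m\<close> of the coefficient of \<open>u\<close>
  replaces \<open>u\<close> by its \<open>m\<close>-fold, on which \<open>f\<close> is divisible by
  \<open>m\<close>. Once all generators have this property, the congruence depends on the base point
  alone.\<close>

lemma splits_cong:
  assumes "additive f" "indep ns J" "m > 0"
  shows "splits {x. int m dvd f x - b} (piece q ns J)"
  using assms(2)
proof (induction "card {j \<in> J. \<not> int m dvd f (ns j)}" arbitrary: q ns rule: less_induct)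
  case less
  have fin: "finite J" using less.prems by (simp add: indep_def)
  show ?case
  proof (cases "\<forall>j\<in>J. int m dvd f (ns j)")
    case True
    have "int m dvd f x - b \<longleftrightarrow> int m dvd f q - b" if x: "x \<in> piece q ns J" for x
    proof -
      obtain c where x: "x = q + par ns J c" using x by (auto simp: piece_def)
      have "int m dvd (\<Sum>j\<in>J. int (c j) * f (ns j))" using True by (intro dvd_sum) auto
      moreover have "f x - b = (f q - b) + (\<Sum>j\<in>J. int (c j) * f (ns j))"
        by (simp add: x add_par[OF assms(1)])
      ultimately show ?thesis by (metis dvd_add_left_iff)
    qed
    then show ?thesis using less.prems by (intro splits_const piecewise_piece) auto
  next
    case False
    then obtain u where u: "u \<in> J" "\<not> int m dvd f (ns u)" by auto
    let ?n = "ns(u := nmul m (ns u))"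
    have IH: "splits {x. int m dvd f x - b} (piece (q + nmul e (ns u)) ?n J)" for e
    proof (rule less.hyps)
      show "card {j \<in> J. \<not> int m dvd f (?n j)} < card {j \<in> J. \<not> int m dvd f (ns j)}"
        by (rule psubset_card_mono) (use fin u in \<open>auto simp: additive_nmul[OF assms(1)]\<close>)
    qed (rule indep_scale[OF less.prems u(1) assms(3)])
    have P: "piece (q + nmul e (ns u)) ?n J = (\<lambda>c. q + par ns J c) ` {c. c u mod m = e}" if e: "e < m" for e
    proof -
      have *: "q + nmul e (ns u) + par ?n J c = q + par ns J (c(u := c u * m + e))" for c
      proof -
        have "par ns J (c(u := c u * m + e)) = par ns J (\<lambda>i. (if i = u then e else 0) + (c(u := c u * m)) i)"
          by (rule par_cong) auto
        then show ?thesis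
          by (subst (asm) par_add) (simp add: par_single[OF fin u(1)] par_scale algebra_simps)
      qed
      show ?thesis
      proof (intro equalityI subsetI)
        fix x assume "x \<in> piece (q + nmul e (ns u)) ?n J"
        then obtain c where x: "x = q + par ns J (c(u := c u * m + e))" unfolding piece_def using * by auto
        show "x \<in> (\<lambda>c. q + par ns J c) ` {c. c u mod m = e}" unfolding x
          by (rule imageI) (use e in auto)
      next
        fix x assume "x \<in> (\<lambda>c. q + par ns J c) ` {c. c u mod m = e}"
        then obtain c where c: "c u mod m = e" and x: "x = q + par ns J c" by auto
        have "q + nmul e (ns u) + par ?n J (c(u := c u div m)) = x"
          unfolding * x using c by (intro arg_cong2[of _ _ _ _ "(+)"] par_cong) auto
        then show "x \<in> piece (q + nmul e (ns u)) ?n J" unfolding piece_def by blast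
      qed
    qed
    have "splits {x. int m dvd f x - b} (\<Union>e<m. (\<lambda>c. q + par ns J c) ` {c. c u mod m = e})"
    proof (rule splits_UN)
      show "(\<lambda>c. q + par ns J c) ` {c. c u mod m = e} \<inter> (\<lambda>c. q + par ns J c) ` {c. c u mod m = e'} = {}"
        if "e \<noteq> e'" for e e'
        using that u(1) by (intro params_disjoint[OF less.prems] bexI[of _ u]) auto
    qed (auto simp: P[symmetric] IH)
    moreover have "(\<Union>e<m. (\<lambda>c. q + par ns J c) ` {c. c u mod m = e}) = piece q ns J"
      unfolding piece_def image_UN[symmetric] using assms(3)
      by (intro arg_cong[of _ _ "\<lambda>A. (\<lambda>c. q + par ns J c) ` A"]) auto
    ultimately show ?thesis by simp
  qed
qed

section \<open>Definable sets\<close>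

text \<open>Quantifier-free formulas of Presburger arithmetic in one variable ranging over the
  group. Congruences are among the atoms since inequalities alone cannot single out a sublattice
  such as the even integers.\<close>

inductive definable :: "'a::ab_group_add set \<Rightarrow> bool" where
  definable_half: "additive f \<Longrightarrow> definable {x. f x \<ge> (b::int)}"
| definable_cong: "additive f \<Longrightarrow> m > 0 \<Longrightarrow> definable {x. int m dvd f x - b}"
| definable_Compl: "definable A \<Longrightarrow> definable (- A)"
| definable_Int: "definable A \<Longrightarrow> definable B \<Longrightarrow> definable (A \<inter> B)"

lemma piecewise_splits:
  assumes "\<And>q ns J. indep ns J \<Longrightarrow> splits D (piece q ns J)" "piecewise A"
  shows "splits D A"
  using assms(2)
proof (induction rule: piecewise.induct)
  case piecewise_empty
  then show ?case by (simp add: splits_def piecewise.piecewise_empty)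
qed (use assms(1) splits_Un in blast)+

text \<open>For an intersection, \<open>A\<close> is first split by \<open>D\<close> and the part
  inside again by \<open>E\<close>; this is why the induction has to run over all
  \<open>A\<close>.\<close>

lemma definable_splits: "definable D \<Longrightarrow> piecewise A \<Longrightarrow> splits D A"
proof (induction arbitrary: A rule: definable.induct)
  case (definable_half f b)
  then show ?case using piecewise_splits splits_half by blast
next
  case (definable_cong f m b)
  then show ?case using piecewise_splits splits_cong by blast
next
  case (definable_Compl D)
  then show ?case by (simp add: splits_compl)
next
  case (definable_Int D E)
  have "splits D A" using definable_Int by blast
  then have 1: "piecewise (A \<inter> D)" "piecewise (A - D)" by (auto simp: splits_def)
  then have 2: "piecewise (A \<inter> D \<inter> E)" "piecewise (A \<inter> D - E)" using definable_Int.IH(2)[of "A \<inter> D"] by (auto simp: splits_def)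
  have "piecewise ((A - D) \<union> (A \<inter> D - E))" using 1 2 by (intro piecewise_Un) auto
  moreover have "(A - D) \<union> (A \<inter> D - E) = A - (D \<inter> E)" by auto
  ultimately show ?case using 2(1) by (simp add: splits_def Int_assoc)
qed

lemma additive_const_zero: "additive (\<lambda>_. 0)"
  by standard simp

lemma definable_UNIV: "definable UNIV"
  using definable_half[OF additive_const_zero, of 0] by simp

lemma definable_empty: "definable {}"
  using definable_Compl[OF definable_UNIV] by simp

lemma definable_Un: "definable A \<Longrightarrow> definable B \<Longrightarrow> definable (A \<union> B)"
  using definable_Compl[OF definable_Int[OF definable_Compl definable_Compl], of A B] by simp

lemma definable_INT: "finite X \<Longrightarrow> (\<And>x. x \<in> X \<Longrightarrow> definable (A x)) \<Longrightarrow> definable (\<Inter>x\<in>X. A x)"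
  by (induction X rule: finite_induct) (auto simp: definable_UNIV intro: definable_Int)

lemma definable_eq: "additive f \<Longrightarrow> definable {x. f x = (b::int)}"
proof -
  assume f: "additive f"
  have "{x. f x = b} = {x. f x \<ge> b} \<inter> - {x. f x \<ge> b + 1}" by auto
  then show ?thesis using f by (auto intro!: definable_Int definable_Compl definable_half)
qed

section \<open>Integer coordinates, orthants and dual functionals\<close>

lemma Zbasis_coords:
  fixes bs :: "'a::ab_group_add list"
  assumes "is_Zbasis bs"
  obtains e :: "nat \<Rightarrow> 'a \<Rightarrow> int" where
    "\<And>j. j < length bs \<Longrightarrow> additive (e j)"
    "\<And>x. x = (\<Sum>j<length bs. zmul (e j x) (bs ! j))"
    "\<And>j c. j < length bs \<Longrightarrow> e j (\<Sum>j<length bs. zmul (c j) (bs ! j)) = c j"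
proof -
  define P where "P x cs \<longleftrightarrow> length cs = length bs \<and> x = (\<Sum>j<length bs. zmul (cs ! j) (bs ! j))" for x and cs :: "int list"
  have ex1: "\<exists>!cs. P x cs" for x using assms unfolding is_Zbasis_def P_def by blast
  define cf where "cf x = (THE cs. P x cs)" for x
  have cf: "P x (cf x)" for x unfolding cf_def by (rule theI'[OF ex1])
  have cfI: "cf x = cs" if "P x cs" for x cs using ex1 cf that by blast
  define e where "e j x = cf x ! j" for j x
  have x: "x = (\<Sum>j<length bs. zmul (e j x) (bs ! j))" for x
    using cf unfolding P_def e_def by blast
  have e: "e j (\<Sum>j<length bs. zmul (c j) (bs ! j)) = c j" if "j < length bs" for j c
  proof -
    have "cf (\<Sum>j<length bs. zmul (c j) (bs ! j)) = map c [0..<length bs]"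
      by (rule cfI) (auto simp: P_def intro!: sum.cong)
    then show ?thesis using that by (simp add: e_def)
  qed
  have "additive (e j)" if "j < length bs" for j
  proof
    fix x y
    have "x + y = (\<Sum>j<length bs. zmul (e j x + e j y) (bs ! j))"
      unfolding zmul_add sum.distrib using x by metis
    then show "e j (x + y) = e j x + e j y" using e[OF that] by metis
  qed
  then show thesis using that x e by blast
qed

text \<open>The group is cut into orthants, one for each set \<open>s\<close> of coordinates that
  are negative. From this decomposition every definable set is later split off.\<close>

lemma piecewise_UNIV:
  assumes "free_fin_rank TYPE('a::ab_group_add)"
  shows "piecewise (UNIV :: 'a set)"
proof -
  obtain bs :: "'a list" where bs: "is_Zbasis bs" using assms by (auto simp: free_fin_rank_def)
  obtain e :: "nat \<Rightarrow> 'a \<Rightarrow> int" where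
    add: "\<And>j. j < length bs \<Longrightarrow> additive (e j)" and
    x: "\<And>x. x = (\<Sum>j<length bs. zmul (e j x) (bs ! j))" and
    e: "\<And>j c. j < length bs \<Longrightarrow> e j (\<Sum>j<length bs. zmul (c j) (bs ! j)) = c j"
    by (rule Zbasis_coords[OF bs]) iprover
  let ?n = "length bs"
  define ns where "ns s j = (if j \<in> s then - (bs ! j) else bs ! j)" for s j
  \<comment> \<open>Negative directions start at -1, since a zero coordinate counts as nonnegative;
    otherwise neighbouring orthants would overlap.\<close>
  define q where "q s = (\<Sum>j<?n. zmul (if j \<in> s then -1 else 0) (bs ! j))" for s :: "nat set"
  have P: "piece (q s) (ns s) {..<?n} = {x. \<forall>j<?n. e j x < 0 \<longleftrightarrow> j \<in> s}" for s
  proof -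
    have *: "q s + par (ns s) {..<?n} c = (\<Sum>j<?n. zmul (if j \<in> s then - int (c j) - 1 else int (c j)) (bs ! j))" for c
      unfolding q_def par_def sum.distrib[symmetric] 
      by (rule sum.cong) (auto simp: ns_def zmul_diff_left zmul_minus_left nmul_minus)
    show ?thesis
    proof (intro equalityI subsetI)
      fix x assume "x \<in> piece (q s) (ns s) {..<?n}"
      then obtain c where "x = (\<Sum>j<?n. zmul (if j \<in> s then - int (c j) - 1 else int (c j)) (bs ! j))"
        using * by (auto simp: piece_def)
      then have "e j x = (if j \<in> s then - int (c j) - 1 else int (c j))" if "j < ?n" for j
        using e[OF that] by simp
      then show "x \<in> {x. \<forall>j<?n. e j x < 0 \<longleftrightarrow> j \<in> s}" by auto
    next
      fix y assume y: "y \<in> {x. \<forall>j<?n. e j x < 0 \<longleftrightarrow> j \<in> s}"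
      have "q s + par (ns s) {..<?n} (\<lambda>j. if j \<in> s then nat (- e j y - 1) else nat (e j y)) = (\<Sum>j<?n. zmul (e j y) (bs ! j))"
        unfolding * by (rule sum.cong) (use y in auto)
      then show "y \<in> piece (q s) (ns s) {..<?n}" using x pieceI by metis
    qed
  qed
  have ind: "indep (ns s) {..<?n}" for s
    unfolding indep_def
  proof (intro conjI allI impI ballI)
    fix c :: "nat \<Rightarrow> int" and j assume 0: "(\<Sum>j<?n. zmul (c j) (ns s j)) = 0" and j: "j \<in> {..<?n}"
    have "(\<Sum>j<?n. zmul (c j) (ns s j)) = (\<Sum>j<?n. zmul (if j \<in> s then - c j else c j) (bs ! j))"
      by (rule sum.cong) (auto simp: ns_def zmul_minus_left zmul_minus_right)
    then have "e j 0 = (if j \<in> s then - c j else c j)" using e[of j "\<lambda>j. if j \<in> s then - c j else c j"] j 0 by simp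
    moreover have "e j 0 = 0" using add[of j] j by (simp add: additive.zero)
    ultimately show "c j = 0" by (auto split: if_splits)
  qed simp
  have "piecewise (\<Union>s\<in>Pow {..<?n}. piece (q s) (ns s) {..<?n})"
  proof (rule piecewise_UN)
    fix s t assume st: "s \<in> Pow {..<?n}" "t \<in> Pow {..<?n}" "s \<noteq> t"
    then obtain j where "j < ?n" "j \<in> s \<longleftrightarrow> j \<notin> t" by (metis Pow_iff lessThan_iff subset_iff subset_antisym)
    then show "piece (q s) (ns s) {..<?n} \<inter> piece (q t) (ns t) {..<?n} = {}" unfolding P by blast
  qed (auto intro: piecewise_piece ind)
  moreover have "(\<Union>s\<in>Pow {..<?n}. piece (q s) (ns s) {..<?n}) = UNIV"
  proof -
    have "x \<in> piece (q {j. j < ?n \<and> e j x < 0}) (ns {j. j < ?n \<and> e j x < 0}) {..<?n}" for x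
      unfolding P by auto
    moreover have "{j. j < ?n \<and> e j x < 0} \<in> Pow {..<?n}" for x by auto
    ultimately show ?thesis by (intro UNIV_eq_I[symmetric] UN_I)
  qed
  ultimately show ?thesis by simp
qed

text \<open>An integral dual basis exists in general only up to a common factor \<open>d\<close>. It
  is built one generator at a time, as in elimination without fractions.\<close>

lemma dual_functionals:
  assumes "free_fin_rank TYPE('a::ab_group_add)" "indep (ns :: nat \<Rightarrow> 'a) J"
  shows "\<exists>F d. d > (0::int) \<and> (\<forall>j\<in>J. additive (F j) \<and> (\<forall>l\<in>J. F j (ns l) = (if l = j then d else 0)))"
proof -
  obtain bs :: "'a list" where bs: "is_Zbasis bs" using assms by (auto simp: free_fin_rank_def)
  obtain e :: "nat \<Rightarrow> 'a \<Rightarrow> int" where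
    add: "\<And>j. j < length bs \<Longrightarrow> additive (e j)" and
    x: "\<And>x. x = (\<Sum>j<length bs. zmul (e j x) (bs ! j))"
    by (rule Zbasis_coords[OF bs]) iprover
  have "finite J" using assms by (simp add: indep_def)
  then show ?thesis using assms(2)
  proof (induction J rule: finite_induct)
    case empty
    then show ?case by (auto intro: exI[of _ 1])
  next
    case (insert i J)
    then have "indep ns J" using indep_subset by blast
    then obtain F d where d: "d > (0::int)" and F: "\<And>j. j \<in> J \<Longrightarrow> additive (F j)"
      "\<And>j l. j \<in> J \<Longrightarrow> l \<in> J \<Longrightarrow> F j (ns l) = (if l = j then d else 0)" using insert.IH by metis
    \<comment> \<open>\<open>p\<close> is \<open>d\<close> times a projection along the generators
      treated so far: it kills them and, by independence, not the new one.\<close>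
    define p where "p x = zmul d x - (\<Sum>j\<in>J. zmul (F j x) (ns j))" for x
    have addp: "p (x + y) = p x + p y" for x y
      by (simp add: p_def zmul_distrib additive.add[OF F(1)] zmul_add sum.distrib)
    have p0: "p (ns l) = 0" if "l \<in> J" for l
    proof -
      have "(\<Sum>j\<in>J. zmul (F j (ns l)) (ns j)) = (\<Sum>j\<in>J. if j = l then zmul d (ns l) else 0)"
        by (rule sum.cong) (use F(2) that in auto)
      then show ?thesis using that insert.hyps by (simp add: p_def)
    qed
    have "p (ns i) \<noteq> 0"
    proof
      assume 0: "p (ns i) = 0"
      have "(\<Sum>j\<in>insert i J. zmul (if j = i then d else - F j (ns i)) (ns j)) =
          zmul d (ns i) + (\<Sum>j\<in>J. - zmul (F j (ns i)) (ns j))"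
        using insert.hyps by (simp, intro sum.cong) (auto simp: zmul_minus_left)
      also have "\<dots> = 0" using 0 by (simp add: p_def sum_negf)
      finally have "(\<Sum>j\<in>insert i J. zmul (if j = i then d else - F j (ns i)) (ns j)) = 0" .
      moreover have "(\<Sum>j\<in>insert i J. zmul (c j) (ns j)) = 0 \<Longrightarrow> c i = 0" for c
        using insert.prems unfolding indep_def by blast
      note this[of "\<lambda>j. if j = i then d else - F j (ns i)"]
      ultimately show False using d by simp
    qed
    moreover have "p (ns i) = 0" if "\<And>k. k < length bs \<Longrightarrow> e k (p (ns i)) = 0"
      by (subst x) (simp add: that)
    ultimately obtain k where k: "k < length bs" "e k (p (ns i)) \<noteq> 0" by blast
    \<comment> \<open>A coordinate that detects \<open>p (ns i)\<close> yields the functional for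
      the new generator; \<open>sgn\<close> makes its value \<open>D\<close> there positive.\<close>
    define g where "g x = sgn (e k (p (ns i))) * e k (p x)" for x
    have g: "additive g" by standard (simp add: g_def addp additive.add[OF add[OF k(1)]] algebra_simps)
    define D where "D = g (ns i)"
    have D: "D > 0" using k(2) by (simp add: D_def g_def sgn_if)
    have gl: "g (ns l) = 0" if "l \<in> J" for l
      using that by (simp add: g_def p0 additive.zero[OF add[OF k(1)]])
    \<comment> \<open>The subtracted term makes the old functionals vanish on \<open>ns i\<close>;
      the factors \<open>d\<close> and \<open>D\<close> bring all diagonal values to
      \<open>d * D\<close>.\<close>
    define F' where "F' j x = (if j = i then d * g x else D * F j x - F j (ns i) * g x)" for j x
    have "additive (F' j)" if "j \<in> insert i J" for j
      using that F(1) insert.hyps by (auto simp: F'_def additive_def additive.add[OF g] algebra_simps)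
    moreover have "F' j (ns l) = (if l = j then d * D else 0)" if "j \<in> insert i J" "l \<in> insert i J" for j l
      using that insert.hyps F(2) gl by (auto simp: F'_def D_def[symmetric])
    moreover have "d * D > 0" using d D by simp
    ultimately show ?case by blast
  qed
qed

text \<open>A point \<open>x\<close> lies in the piece iff \<open>x - q\<close> is in the rational
  span of the generators, expressed by \<open>p x = p q\<close>, and its coefficients
  \<open>F j (x - q) div d\<close> are natural numbers without remainder. These are finitely many
  equations, inequalities and congruences.\<close>

lemma piecewise_imp_definable:
  assumes fr: "free_fin_rank TYPE('a::ab_group_add)" and "piecewise (A :: 'a set)"
  shows "definable A"
  using assms(2)
proof (induction rule: piecewise.induct)
  case piecewise_empty
  then show ?case by (rule definable_empty)
next
  case (piecewise_Un A B)
  then show ?case by (simp add: definable_Un)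
next
  case (piecewise_piece ns J q)
  obtain bs :: "'a list" where bs: "is_Zbasis bs" using fr by (auto simp: free_fin_rank_def)
  obtain e :: "nat \<Rightarrow> 'a \<Rightarrow> int" where
    add: "\<And>j. j < length bs \<Longrightarrow> additive (e j)" and
    x: "\<And>x. x = (\<Sum>j<length bs. zmul (e j x) (bs ! j))"
    by (rule Zbasis_coords[OF bs]) iprover
  have fin: "finite J" using piecewise_piece by (simp add: indep_def)
  have ext: "u = v" if "\<And>j. j < length bs \<Longrightarrow> e j u = e j v" for u v
  proof -
    have "(\<Sum>j<length bs. zmul (e j u) (bs ! j)) = (\<Sum>j<length bs. zmul (e j v) (bs ! j))"
      using that by (intro sum.cong) auto
    then show ?thesis using x by metis
  qed
  obtain F d where d: "d > (0::int)" and F: "\<And>j. j \<in> J \<Longrightarrow> additive (F j)"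
    "\<And>j l. j \<in> J \<Longrightarrow> l \<in> J \<Longrightarrow> F j (ns l) = (if l = j then d else 0)"
    using dual_functionals[OF fr piecewise_piece] by metis
  define p where "p x = zmul d x - (\<Sum>j\<in>J. zmul (F j x) (ns j))" for x
  have p: "additive p"
    by standard (simp add: p_def zmul_distrib additive.add[OF F(1)] zmul_add sum.distrib)
  have ep: "additive (\<lambda>x. e k (p x))" if "k < length bs" for k
    by standard (simp add: additive.add[OF p] additive.add[OF add[OF that]])
  have Fpar: "F j (par ns J c) = d * int (c j)" if "j \<in> J" for j c
  proof -
    have "F j (par ns J c) = (\<Sum>l\<in>J. if l = j then d * int (c j) else 0)"
      unfolding par_def additive.sum[OF F(1)[OF that]] additive_nmul[OF F(1)[OF that]]
      by (rule sum.cong) (use F(2) that in auto)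
    then show ?thesis using fin that by simp
  qed
  have par_zmul: "par ns J c = (\<Sum>j\<in>J. zmul (int (c j)) (ns j))" for c
    by (simp add: par_def)
  have "piece q ns J = (\<Inter>k\<in>{..<length bs}. {x. e k (p x) = e k (p q)}) \<inter>
      (\<Inter>j\<in>J. {x. F j x \<ge> F j q} \<inter> {x. int (nat d) dvd F j x - F j q})" (is "_ = ?R")
  proof (intro equalityI subsetI)
    fix x assume "x \<in> piece q ns J"
    then obtain c where c: "x = q + par ns J c" by (rule pieceE)
    have "zmul d (par ns J c) = (\<Sum>j\<in>J. zmul (F j (par ns J c)) (ns j))"
      unfolding par_zmul zmul_sum_right using Fpar[unfolded par_zmul] by (intro sum.cong) (simp_all only: zmul_mult)
    then have "p (par ns J c) = 0" by (simp add: p_def)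
    then have "p x = p q" by (simp add: c additive.add[OF p])
    then show "x \<in> ?R" using d by (auto simp: c additive.add[OF F(1)] Fpar)
  next
    fix x assume x: "x \<in> ?R"
    then have "p x = p q" by (intro ext) auto
    then have p0: "p (x - q) = 0" by (simp add: additive.diff[OF p])
    define c where "c j = nat (F j (x - q) div d)" for j
    have c: "F j (x - q) = d * int (c j)" if "j \<in> J" for j
    proof -
      have "F j (x - q) = F j x - F j q" by (rule additive.diff[OF F(1)[OF that]])
      then have "d dvd F j (x - q)" "F j (x - q) \<ge> 0" using x that d by auto
      then show ?thesis using d by (simp add: c_def pos_imp_zdiv_nonneg_iff)
    qed
    have "zmul d (x - q) = (\<Sum>j\<in>J. zmul (d * int (c j)) (ns j))"
      using p0 c by (simp add: p_def)
    also have "\<dots> = zmul d (par ns J c)" unfolding par_zmul zmul_sum_right zmul_mult ..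
    finally have dd: "zmul d (x - q) = zmul d (par ns J c)" .
    \<comment> \<open>The factor \<open>d\<close> is cancelled coordinatewise, the group being
      torsion-free.\<close>
    have "x - q = par ns J c"
    proof (rule ext)
      fix j assume "j < length bs"
      then have "e j (zmul d u) = d * e j u" for u using additive_zmul[OF add] by simp
      then show "e j (x - q) = e j (par ns J c)" using dd d by (metis mult_left_cancel less_irrefl)
    qed
    then have "x = q + par ns J c" by (simp add: algebra_simps)
    then show "x \<in> piece q ns J" by (simp add: pieceI)
  qed
  moreover have "definable ?R"
    using fin d F(1) ep by (intro definable_Int definable_INT definable_eq definable_half definable_cong) auto
  ultimately show ?case by simp
qed

text \<open>Along the ray an inequality is eventually decided by the sign of \<open>f a\<close>, and
  is constant if \<open>f a = 0\<close>; a congruence is constant once its modulus divides the step.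
  Admitting every multiple \<open>m'\<close> of \<open>m\<close> lets conditions with different
  periods be combined.\<close>

lemma definable_eventually:
  assumes "definable P"
  shows "\<exists>m>0. \<forall>m'>0. m dvd m' \<longrightarrow>
    (\<exists>P'. definable P' \<and> (\<forall>g. \<forall>\<^sub>F k in sequentially. g + nmul (k * m') a \<in> P \<longleftrightarrow> g \<in> P'))"
  using assms
proof (induction rule: definable.induct)
  case (definable_half f b)
  have f: "f (g + nmul (k * m') a) = f g + int (k * m') * f a" for g k m'
    by (simp add: additive.add[OF definable_half] additive_nmul[OF definable_half])
  have "\<exists>P'. definable P' \<and> (\<forall>g. \<forall>\<^sub>F k in sequentially. g + nmul (k * m') a \<in> {x. f x \<ge> b} \<longleftrightarrow> g \<in> P')" if "m' > 0" for m'
  proof -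
    have big: "x \<le> int (k * m') * y" if "k \<ge> nat x" "y > 0" for x y :: int and k
    proof -
      have "x \<le> int k" using that by simp
      also have "\<dots> \<le> int k * (int m' * y)" using \<open>m' > 0\<close> \<open>y > 0\<close>
        by (intro mult_le_cancel_left1[THEN iffD2]) (auto simp: int_one_le_iff_zero_less)
      finally show ?thesis by (simp add: mult.assoc)
    qed
    consider "f a = 0" | "f a > 0" | "f a < 0" by linarith
    then show ?thesis
    proof cases
      case 1
      then show ?thesis using definable_half by (intro exI[of _ "{x. f x \<ge> b}"]) (auto simp: f intro: definable.definable_half)
    next
      case 2
      have "\<forall>\<^sub>F k in sequentially. g + nmul (k * m') a \<in> {x. f x \<ge> b}" for g
        using eventually_ge_at_top[of "nat (b - f g)"]
        by eventually_elim (use big 2 in \<open>force simp: f\<close>)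
      then show ?thesis by (intro exI[of _ UNIV]) (simp add: definable_UNIV)
    next
      case 3
      have "\<forall>\<^sub>F k in sequentially. g + nmul (k * m') a \<notin> {x. f x \<ge> b}" for g
        using eventually_ge_at_top[of "nat (f g - b + 1)"]
      proof eventually_elim
        case (elim k)
        then show ?case using big[OF elim, of "- f a"] 3 by (simp add: f)
      qed
      then show ?thesis by (intro exI[of _ "{}"]) (simp add: definable_empty)
    qed
  qed
  then show ?case by (intro exI[of _ 1]) blast
next
  case (definable_cong f m b)
  show ?case
  proof (rule exI[of _ m], intro conjI allI impI)
    fix m' assume "m dvd m'"
    then have "int m dvd int (k * m') * f a" for k by simp
    moreover have "f (g + nmul (k * m') a) - b = f g - b + int (k * m') * f a" for g k
      by (simp add: additive.add[OF definable_cong(1)] additive_nmul[OF definable_cong(1)])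
    ultimately have "int m dvd f (g + nmul (k * m') a) - b \<longleftrightarrow> int m dvd f g - b" for g k
      by (metis dvd_add_left_iff)
    then show "\<exists>P'. definable P' \<and> (\<forall>g. \<forall>\<^sub>F k in sequentially. g + nmul (k * m') a \<in> {x. int m dvd f x - b} \<longleftrightarrow> g \<in> P')"
      using definable_cong by (intro exI[of _ "{x. int m dvd f x - b}"]) (auto intro: definable.definable_cong)
  qed (rule definable_cong)
next
  case (definable_Compl P)
  then obtain m where "m > 0" and m: "\<forall>m'>0. m dvd m' \<longrightarrow>
    (\<exists>P'. definable P' \<and> (\<forall>g. \<forall>\<^sub>F k in sequentially. g + nmul (k * m') a \<in> P \<longleftrightarrow> g \<in> P'))" by blast
  show ?case
  proof (rule exI[of _ m], intro conjI allI impI)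
    fix m' :: nat assume "m' > 0" "m dvd m'"
    then obtain P' where "definable P'" "\<forall>g. \<forall>\<^sub>F k in sequentially. g + nmul (k * m') a \<in> P \<longleftrightarrow> g \<in> P'"
      using m by blast
    then show "\<exists>P'. definable P' \<and> (\<forall>g. \<forall>\<^sub>F k in sequentially. g + nmul (k * m') a \<in> - P \<longleftrightarrow> g \<in> P')"
      by (intro exI[of _ "- P'"]) (auto intro: definable.definable_Compl)
  qed fact
next
  case (definable_Int P R)
  from definable_Int.IH obtain m n where "m > 0" "n > 0" and m: "\<forall>m'>0. m dvd m' \<longrightarrow>
    (\<exists>P'. definable P' \<and> (\<forall>g. \<forall>\<^sub>F k in sequentially. g + nmul (k * m') a \<in> P \<longleftrightarrow> g \<in> P'))"
    and n: "\<forall>m'>0. n dvd m' \<longrightarrow>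
    (\<exists>P'. definable P' \<and> (\<forall>g. \<forall>\<^sub>F k in sequentially. g + nmul (k * m') a \<in> R \<longleftrightarrow> g \<in> P'))" by (elim exE conjE)
  show ?case
  proof (rule exI[of _ "m * n"], intro conjI allI impI)
    fix m' :: nat assume "m' > 0" "m * n dvd m'"
    then have "m dvd m'" "n dvd m'" by (auto dest: dvd_mult_left dvd_mult_right)
    then obtain P' R' where "definable P'" and P': "\<And>g. \<forall>\<^sub>F k in sequentially. g + nmul (k * m') a \<in> P \<longleftrightarrow> g \<in> P'"
      and "definable R'" and R': "\<And>g. \<forall>\<^sub>F k in sequentially. g + nmul (k * m') a \<in> R \<longleftrightarrow> g \<in> R'"
      using m n \<open>m' > 0\<close> by metis
    have "\<forall>\<^sub>F k in sequentially. g + nmul (k * m') a \<in> P \<inter> R \<longleftrightarrow> g \<in> P' \<inter> R'" for g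
      using P'[of g] R'[of g] by eventually_elim auto
    then show "\<exists>P'. definable P' \<and> (\<forall>g. \<forall>\<^sub>F k in sequentially. g + nmul (k * m') a \<in> P \<inter> R \<longleftrightarrow> g \<in> P')"
      using \<open>definable P'\<close> \<open>definable R'\<close> by (blast intro: definable.definable_Int)
  qed (use \<open>m > 0\<close> \<open>n > 0\<close> in simp)
qed

section \<open>Constructibility from a finite-dimensional model\<close>

text \<open>A basis of \<open>A \<inter> B\<close> is extended to one of \<open>A\<close>, and the
  added vectors are a basis of \<open>A\<close> modulo \<open>B\<close>. The span of the finite set
  \<open>X\<close> bounds their number.\<close>

lemma (in vector_space) quotient_basis_exists:
  assumes A: "subspace A" and B: "subspace B" and "finite X" "A \<subseteq> span X"
  shows "\<exists>R u. (\<forall>s<R. u s \<in> A) \<and> (\<forall>c. lincomb scale R c u \<in> B \<longrightarrow> (\<forall>s<R. c s = 0)) \<and>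
     (\<forall>a\<in>A. \<exists>c. a - lincomb scale R c u \<in> B)"
proof -
  obtain U where U: "U \<subseteq> A \<inter> B" "independent U" "A \<inter> B \<subseteq> span U"
    by (rule basis_exists)
  have "U \<subseteq> A" using U by auto
  then obtain W where W: "U \<subseteq> W" "W \<subseteq> A" "independent W" "A \<subseteq> span W"
    using U(2) by (rule maximal_independent_subset_extend)
  have "W \<subseteq> span X" using W(2) assms(4) by (rule subset_trans)
  then have fW: "finite W" using independent_span_bound[OF assms(3) W(3)] by simp
  then have fU: "finite U" using W(1) finite_subset by blast
  obtain u where u: "bij_betw u {..<card (W - U)} (W - U)"
    using fW by (metis ex_bij_betw_nat_finite finite_Diff lessThan_atLeast0)
  let ?R = "card (W - U)"
  have lc: "lincomb scale ?R c u = (\<Sum>w\<in>W - U. scale (c (inv_into {..<?R} u w)) w)" for c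
    unfolding lincomb_def sum.reindex_bij_betw[OF u, symmetric]
    by (rule sum.cong) (use u in \<open>auto simp: bij_betw_def\<close>)
  have uA: "u s \<in> A" if "s < ?R" for s
    using that u W(2) by (auto simp: bij_betw_def)
  have "c s = 0" if c: "lincomb scale ?R c u \<in> B" and s: "s < ?R" for c s
  proof -
    let ?c = "\<lambda>w. c (inv_into {..<?R} u w)"
    have "lincomb scale ?R c u \<in> A" unfolding lincomb_def
      using uA by (intro subspace_sum[OF A] subspace_scale[OF A]) auto
    \<comment> \<open>The combination lies in \<open>A \<inter> B\<close>, hence is also one of
      vectors in \<open>U\<close>; the difference of the two is a relation in the independent set
      \<open>W\<close>.\<close>
    with c U(3) have "lincomb scale ?R c u \<in> span U" by blast
    then obtain a where a: "lincomb scale ?R c u = (\<Sum>v\<in>U. scale (a v) v)"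
      by (auto simp: span_finite[OF fU])
    let ?k = "\<lambda>w. if w \<in> U then - a w else ?c w"
    have "(\<Sum>w\<in>W. scale (?k w) w) = (\<Sum>w\<in>W - U. scale (?k w) w) + (\<Sum>w\<in>U. scale (?k w) w)"
      by (rule sum.subset_diff[OF W(1) fW])
    also have "(\<Sum>w\<in>W - U. scale (?k w) w) = lincomb scale ?R c u"
      unfolding lc by (rule sum.cong) auto
    also have "(\<Sum>w\<in>U. scale (?k w) w) = - (\<Sum>w\<in>U. scale (a w) w)"
      by (simp add: sum_negf)
    finally have "(\<Sum>w\<in>W. scale (?k w) w) = 0" using a by simp
    moreover have us: "u s \<in> W - U" using u s by (auto simp: bij_betw_def)
    ultimately have "?k (u s) = 0" using independentD[OF W(3) fW subset_refl, of ?k] by blast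
    then show "c s = 0" using us u s by (simp add: bij_betw_def)
  qed
  moreover have "\<exists>c. a - lincomb scale ?R c u \<in> B" if "a \<in> A" for a
  proof -
    have "a \<in> span W" using that W(4) by auto
    then obtain k where k: "a = (\<Sum>w\<in>W. scale (k w) w)" by (auto simp: span_finite[OF fW])
    have "lincomb scale ?R (\<lambda>s. k (u s)) u = (\<Sum>w\<in>W - U. scale (k w) w)"
      unfolding lincomb_def by (rule sum.reindex_bij_betw[OF u])
    then have "a - lincomb scale ?R (\<lambda>s. k (u s)) u = (\<Sum>w\<in>U. scale (k w) w)"
      unfolding k sum.subset_diff[OF W(1) fW, of "\<lambda>w. scale (k w) w"] by simp
    moreover have "(\<Sum>w\<in>U. scale (k w) w) \<in> B"
      using U(1) by (intro subspace_sum[OF B] subspace_scale[OF B]) auto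
    ultimately show ?thesis by metis
  qed
  ultimately show ?thesis using uA by blast
qed

text \<open>Passes from regions labelled by the values of a function to the numbered list in
  \<open>constructible\<close>. In the application a label is itself a function, assigning a region
  number to each \<open>S\<close>.\<close>

lemma constructible_of_regions:
  assumes fin: "finite (range reg)" and ss: "\<And>\<rho>. semisimple {g. reg g = \<rho>}"
    and zb: "\<And>g. (\<forall>s < R (reg g). zb g s \<in> Z g) \<and>
          (\<forall>c. lincomb sc (R (reg g)) c (zb g) \<in> B g \<longrightarrow> (\<forall>s < R (reg g). c s = 0)) \<and>
          (\<forall>z \<in> Z g. \<exists>c. z - lincomb sc (R (reg g)) c (zb g) \<in> B g)"
    and C: "\<And>g h s. h - g \<in> Gp \<Longrightarrow> s < R (reg g) \<Longrightarrow>
          psi g h (zb g s) - lincomb sc (R (reg h)) (\<lambda>t. C (reg g) (reg h) t s) (zb h) \<in> B h"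
  shows "constructible sc Gp Z B psi"
proof -
  obtain rs where rs: "set rs = range reg" "distinct rs" using finite_distinct_list[OF fin] by blast
  let ?parts = "map (\<lambda>\<rho>. {g. reg g = \<rho>}) rs"
  show ?thesis
    unfolding constructible_def
  proof (rule exI[of _ ?parts], rule exI[of _ "\<lambda>I. R (rs ! I)"], rule exI[of _ "\<lambda>I. zb"],
      rule exI[of _ "\<lambda>I J. C (rs ! I) (rs ! J)"], intro conjI)
    show "\<forall>P\<in>set ?parts. semisimple P" using ss by auto
    show "\<forall>I J. I < length ?parts \<and> J < length ?parts \<and> I \<noteq> J \<longrightarrow> ?parts ! I \<inter> ?parts ! J = {}"
      using rs(2) by (auto simp: distinct_conv_nth)
    show "(\<Union>P\<in>set ?parts. P) = UNIV" using rs(1) by auto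
    show "\<forall>I < length ?parts. \<forall>g \<in> ?parts ! I.
          (\<forall>s < R (rs ! I). zb g s \<in> Z g) \<and>
          (\<forall>c. lincomb sc (R (rs ! I)) c (zb g) \<in> B g \<longrightarrow> (\<forall>s < R (rs ! I). c s = 0)) \<and>
          (\<forall>z \<in> Z g. \<exists>c. z - lincomb sc (R (rs ! I)) c (zb g) \<in> B g)"
    proof (intro allI impI ballI)
      fix I g assume "I < length ?parts" "g \<in> ?parts ! I"
      then have g: "rs ! I = reg g" by simp
      show "(\<forall>s < R (rs ! I). zb g s \<in> Z g) \<and>
          (\<forall>c. lincomb sc (R (rs ! I)) c (zb g) \<in> B g \<longrightarrow> (\<forall>s < R (rs ! I). c s = 0)) \<and>
          (\<forall>z \<in> Z g. \<exists>c. z - lincomb sc (R (rs ! I)) c (zb g) \<in> B g)"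
        unfolding g by (rule zb)
    qed
    show "\<forall>I < length ?parts. \<forall>J < length ?parts. \<forall>g \<in> ?parts ! I. \<forall>h \<in> ?parts ! J. h - g \<in> Gp \<longrightarrow>
          (\<forall>s < R (rs ! I). psi g h (zb g s) - lincomb sc (R (rs ! J)) (\<lambda>t. C (rs ! I) (rs ! J) t s) (zb h) \<in> B h)"
    proof (intro allI impI ballI)
      fix I J g h s assume "I < length ?parts" "g \<in> ?parts ! I" "J < length ?parts" "h \<in> ?parts ! J"
        and *: "h - g \<in> Gp" "s < R (rs ! I)"
      then have g: "rs ! I = reg g" "rs ! J = reg h" by simp_all
      show "psi g h (zb g s) - lincomb sc (R (rs ! J)) (\<lambda>t. C (rs ! I) (rs ! J) t s) (zb h) \<in> B h"
        using * unfolding g by (rule C)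
    qed
  qed
qed

text \<open>The image of \<open>e g\<close> contains \<open>A (reg g)\<close>, and
  \<open>Z g\<close>, \<open>B g\<close> are the preimages of \<open>A (reg g)\<close> and
  \<open>D (reg g)\<close>; so \<open>e g\<close> identifies \<open>Z g\<close> modulo
  \<open>B g\<close> with a quotient that depends on the label only. A basis chosen once per label
  is lifted to every \<open>g\<close>, and \<open>\<Theta>\<close> supplies the matrices.\<close>

lemma constructible_from_model:
  fixes sw :: "'k::field \<Rightarrow> 'w::ab_group_add \<Rightarrow> 'w" and sx :: "'k \<Rightarrow> 'x::ab_group_add \<Rightarrow> 'x"
  assumes vw: "vector_space sw" and vx: "vector_space sx"
    and fin: "finite (range reg)" and ss: "\<And>\<rho>. semisimple {g. reg g = \<rho>}"
    and F: "\<And>g. module.subspace sw (F g)"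
    and e_add: "\<And>g f f'. f \<in> F g \<Longrightarrow> f' \<in> F g \<Longrightarrow> e g (f + f') = e g f + e g f'"
    and e_scale: "\<And>g c f. f \<in> F g \<Longrightarrow> e g (sw c f) = sx c (e g f)"
    and A: "\<And>\<rho>. module.subspace sx (A \<rho>)" and D: "\<And>\<rho>. module.subspace sx (D \<rho>)"
    and X: "\<And>\<rho>. finite (X \<rho>)" "\<And>\<rho>. A \<rho> \<subseteq> module.span sx (X \<rho>)"
    and surj: "\<And>g. A (reg g) \<subseteq> e g ` F g"
    and Z: "\<And>g. Z g = {f \<in> F g. e g f \<in> A (reg g)}"
    and B: "\<And>g. B g = {f \<in> F g. e g f \<in> D (reg g)}"
    and psi: "\<And>g h f. h - g \<in> Gp \<Longrightarrow> f \<in> Z g \<Longrightarrow> psi g h f \<in> Z h"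
    and e_psi: "\<And>g h f. h - g \<in> Gp \<Longrightarrow> f \<in> F g \<Longrightarrow> e h (psi g h f) = \<Theta> (reg g) (reg h) (e g f)"
  shows "constructible sw Gp Z B psi"
proof -
  interpret w: vector_space sw by fact
  interpret x: vector_space sx by fact
  have ex: "\<exists>R u. (\<forall>s<R. u s \<in> A \<rho>) \<and> (\<forall>c. lincomb sx R c u \<in> D \<rho> \<longrightarrow> (\<forall>s<R. c s = 0)) \<and>
     (\<forall>a\<in>A \<rho>. \<exists>c. a - lincomb sx R c u \<in> D \<rho>)" for \<rho>
    by (rule x.quotient_basis_exists[OF A D X])
  have "\<exists>R. \<forall>\<rho>. \<exists>u. (\<forall>s<R \<rho>. u s \<in> A \<rho>) \<and> (\<forall>c. lincomb sx (R \<rho>) c u \<in> D \<rho> \<longrightarrow> (\<forall>s<R \<rho>. c s = 0)) \<and>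
     (\<forall>a\<in>A \<rho>. \<exists>c. a - lincomb sx (R \<rho>) c u \<in> D \<rho>)"
    by (intro choice allI ex)
  then obtain R where "\<forall>\<rho>. \<exists>u. (\<forall>s<R \<rho>. u s \<in> A \<rho>) \<and> (\<forall>c. lincomb sx (R \<rho>) c u \<in> D \<rho> \<longrightarrow> (\<forall>s<R \<rho>. c s = 0)) \<and>
     (\<forall>a\<in>A \<rho>. \<exists>c. a - lincomb sx (R \<rho>) c u \<in> D \<rho>)" ..
  then have "\<exists>u. \<forall>\<rho>. (\<forall>s<R \<rho>. u \<rho> s \<in> A \<rho>) \<and> (\<forall>c. lincomb sx (R \<rho>) c (u \<rho>) \<in> D \<rho> \<longrightarrow> (\<forall>s<R \<rho>. c s = 0)) \<and>
     (\<forall>a\<in>A \<rho>. \<exists>c. a - lincomb sx (R \<rho>) c (u \<rho>) \<in> D \<rho>)"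
    by (rule choice)
  then obtain u where u0: "\<forall>\<rho>. (\<forall>s<R \<rho>. u \<rho> s \<in> A \<rho>) \<and> (\<forall>c. lincomb sx (R \<rho>) c (u \<rho>) \<in> D \<rho> \<longrightarrow> (\<forall>s<R \<rho>. c s = 0)) \<and>
     (\<forall>a\<in>A \<rho>. \<exists>c. a - lincomb sx (R \<rho>) c (u \<rho>) \<in> D \<rho>)" ..
  have u: "s < R \<rho> \<Longrightarrow> u \<rho> s \<in> A \<rho>"
    "lincomb sx (R \<rho>) c (u \<rho>) \<in> D \<rho> \<Longrightarrow> s < R \<rho> \<Longrightarrow> c s = 0"
    "a \<in> A \<rho> \<Longrightarrow> \<exists>c. a - lincomb sx (R \<rho>) c (u \<rho>) \<in> D \<rho>" for \<rho> s c a
    using spec[OF u0, of \<rho>] by blast+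
  have "\<exists>f. s < R (reg g) \<longrightarrow> f \<in> F g \<and> e g f = u (reg g) s" for g s
  proof (cases "s < R (reg g)")
    case True
    then obtain f where "u (reg g) s = e g f" "f \<in> F g" using u(1) surj by (meson imageE subsetD)
    then show ?thesis by metis
  qed simp
  then have "\<exists>zb. \<forall>g s. s < R (reg g) \<longrightarrow> zb g s \<in> F g \<and> e g (zb g s) = u (reg g) s"
    by (intro choice allI)
  then obtain zb where zb0: "\<forall>g s. s < R (reg g) \<longrightarrow> zb g s \<in> F g \<and> e g (zb g s) = u (reg g) s" ..
  have zb: "s < R (reg g) \<Longrightarrow> zb g s \<in> F g" "s < R (reg g) \<Longrightarrow> e g (zb g s) = u (reg g) s" for g s
    using spec[OF spec[OF zb0, of g], of s] by simp_all
  have lcF: "lincomb sw m c y \<in> F g" if "\<And>s. s < m \<Longrightarrow> y s \<in> F g" for g m c y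
    unfolding lincomb_def using that by (intro w.subspace_sum[OF F] w.subspace_scale[OF F]) auto
  have e0: "e g 0 = 0" for g using e_add[OF w.subspace_0[OF F] w.subspace_0[OF F], of g] by simp
  have e_lc: "e g (lincomb sw m c y) = lincomb sx m c (\<lambda>s. e g (y s))" if "\<And>s. s < m \<Longrightarrow> y s \<in> F g" for g m c y
    using that
  proof (induction m)
    case 0
    then show ?case by (simp add: lincomb_def e0)
  next
    case (Suc m)
    then have "e g (lincomb sw m c y + sw (c m) (y m)) = e g (lincomb sw m c y) + sx (c m) (e g (y m))"
      by (subst e_add[OF lcF w.subspace_scale[OF F]]) (auto simp: e_scale)
    then show ?case using Suc by (simp add: lincomb_def)
  qed
  have e_zb: "e g (lincomb sw (R (reg g)) c (zb g)) = lincomb sx (R (reg g)) c (u (reg g))" for g c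
    using e_lc[where g = g and m = "R (reg g)" and y = "zb g" and c = c, OF zb(1)]
    by (simp add: lincomb_def zb(2))
  have e_diff: "e g (f - f') = e g f - e g f'" if "f \<in> F g" "f' \<in> F g" for g f f'
    using e_add[OF w.subspace_diff[OF F that] that(2)] by (simp add: algebra_simps)
  \<comment> \<open>A comparable pair with these labels is what shows that
    \<open>\<Theta> \<rho> \<sigma>\<close> sends the basis vector into \<open>A \<sigma>\<close>.
    The coefficients serve all such pairs, because \<open>\<Theta>\<close> sees only the
    labels.\<close>
  have "\<exists>c. s < R \<rho> \<longrightarrow> (\<exists>g h. reg g = \<rho> \<and> reg h = \<sigma> \<and> h - g \<in> Gp) \<longrightarrow> \<Theta> \<rho> \<sigma> (u \<rho> s) - lincomb sx (R \<sigma>) c (u \<sigma>) \<in> D \<sigma>"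
    for \<rho> \<sigma> s
  proof (cases "s < R \<rho> \<and> (\<exists>g h. reg g = \<rho> \<and> reg h = \<sigma> \<and> h - g \<in> Gp)")
    case True
    then obtain g h where s: "s < R \<rho>" and gh: "reg g = \<rho>" "reg h = \<sigma>" "h - g \<in> Gp" by blast
    then have "zb g s \<in> Z g" using zb u(1) s by (simp add: Z)
    then have "psi g h (zb g s) \<in> Z h" using psi gh by blast
    then have "\<Theta> \<rho> \<sigma> (u \<rho> s) \<in> A \<sigma>" using e_psi[OF gh(3) zb(1)] zb(2) gh s by (simp add: Z)
    then show ?thesis using u(3) by blast
  qed blast
  then have "\<exists>C0. \<forall>\<rho> \<sigma> s. s < R \<rho> \<longrightarrow> (\<exists>g h. reg g = \<rho> \<and> reg h = \<sigma> \<and> h - g \<in> Gp) \<longrightarrow>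
      \<Theta> \<rho> \<sigma> (u \<rho> s) - lincomb sx (R \<sigma>) (C0 \<rho> \<sigma> s) (u \<sigma>) \<in> D \<sigma>"
    by (intro choice allI)
  then obtain C0 where C00: "\<forall>\<rho> \<sigma> s. s < R \<rho> \<longrightarrow> (\<exists>g h. reg g = \<rho> \<and> reg h = \<sigma> \<and> h - g \<in> Gp) \<longrightarrow>
      \<Theta> \<rho> \<sigma> (u \<rho> s) - lincomb sx (R \<sigma>) (C0 \<rho> \<sigma> s) (u \<sigma>) \<in> D \<sigma>" ..
  have C0: "\<Theta> (reg g) (reg h) (u (reg g) s) - lincomb sx (R (reg h)) (C0 (reg g) (reg h) s) (u (reg h)) \<in> D (reg h)"
    if "s < R (reg g)" "h - g \<in> Gp" for g h s
    using spec[OF spec[OF spec[OF C00, of "reg g"], of "reg h"], of s] that by blast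
  show ?thesis
  proof (rule constructible_of_regions[OF fin ss, of R zb _ _ _ _ _ "\<lambda>\<rho> \<sigma> t s. C0 \<rho> \<sigma> s t"], intro conjI allI impI ballI)
    fix g s assume "s < R (reg g)"
    then show "zb g s \<in> Z g" using zb u(1) by (simp add: Z)
  next
    fix g c s assume "lincomb sw (R (reg g)) c (zb g) \<in> B g" "s < R (reg g)"
    then show "c s = 0" using u(2) by (auto simp: B e_zb)
  next
    fix g f assume f: "f \<in> Z g"
    then obtain c where "e g f - lincomb sx (R (reg g)) c (u (reg g)) \<in> D (reg g)" using u(3) by (auto simp: Z)
    moreover have "lincomb sw (R (reg g)) c (zb g) \<in> F g" using lcF zb(1) by blast
    ultimately have "f - lincomb sw (R (reg g)) c (zb g) \<in> B g"
      using f w.subspace_diff[OF F] by (auto simp: B Z e_zb e_diff)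
    then show "\<exists>c. f - lincomb sw (R (reg g)) c (zb g) \<in> B g" by blast
  next
    fix g h s assume gh: "h - g \<in> Gp" and s: "s < R (reg g)"
    have "zb g s \<in> Z g" using zb u(1) s by (simp add: Z)
    then have p: "psi g h (zb g s) \<in> F h" using psi[OF gh] by (auto simp: Z)
    have l: "lincomb sw (R (reg h)) (\<lambda>t. C0 (reg g) (reg h) s t) (zb h) \<in> F h" using lcF zb(1) by blast
    show "psi g h (zb g s) - lincomb sw (R (reg h)) (\<lambda>t. C0 (reg g) (reg h) s t) (zb h) \<in> B h"
      using w.subspace_diff[OF F p l] C0[OF s gh] zb s
      by (simp add: B e_diff[OF p l] e_psi[OF gh] e_zb)
  qed
qed

section \<open>The Cech complex of a constructible module\<close>

lemma lincomb_cong: "(\<And>s. s < n \<Longrightarrow> c s = c' s) \<Longrightarrow> lincomb sc n c z = lincomb sc n c' z"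
  by (simp add: lincomb_def)

lemma span_sc_eq_span: "vector_space sc \<Longrightarrow> span_sc sc X = module.span sc X"
  unfolding span_sc_def by (subst module.span_explicit) (auto simp: module_iff_vector_space)

lemma vector_space_fsc:
  assumes "vector_space sc" shows "vector_space (fsc sc)"
proof -
  interpret vector_space sc by fact
  show ?thesis
    by standard (auto simp: fsc_def fun_eq_iff scale_right_distrib scale_left_distrib)
qed

text \<open>Collects the regions, bases and matrices of the given module together with the eventual
  regions \<open>reg g S\<close>. Convergence of \<open>reg0\<close> is asked for only along
  multiples of \<open>M\<close>, since in between the points may cycle through several
  regions.\<close>

locale cech_data = vector_space sc
  for sc :: "'k::field \<Rightarrow> 'v::ab_group_add \<Rightarrow> 'v" +
  fixes Gp :: "('z::ab_group_add \<times> 'q::ab_group_add) set"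
    and V :: "'z \<times> 'q \<Rightarrow> 'v set"
    and act :: "'z \<times> 'q \<Rightarrow> 'z \<times> 'q \<Rightarrow> 'v \<Rightarrow> 'v"
    and as :: "'q list"
    and reg0 :: "'z \<times> 'q \<Rightarrow> nat"
    and r :: "nat \<Rightarrow> nat"
    and z :: "'z \<times> 'q \<Rightarrow> nat \<Rightarrow> 'v"
    and C :: "nat \<Rightarrow> nat \<Rightarrow> nat \<Rightarrow> nat \<Rightarrow> 'k"
    and M :: nat
    and reg :: "'z \<times> 'q \<Rightarrow> nat set \<Rightarrow> nat"
  assumes gm: "gmodule sc Gp V act"
    and Gp_0: "0 \<in> Gp" and Gp_add: "a \<in> Gp \<Longrightarrow> b \<in> Gp \<Longrightarrow> a + b \<in> Gp"
    and degS_diff: "S \<subseteq> T \<Longrightarrow> T \<subseteq> {..<length as} \<Longrightarrow> degS as T - degS as S \<in> Gp"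
    and z_V: "s < r (reg0 g) \<Longrightarrow> z g s \<in> V g"
    and z_indep: "lincomb sc (r (reg0 g)) c (z g) = 0 \<Longrightarrow> s < r (reg0 g) \<Longrightarrow> c s = 0"
    and z_span: "v \<in> V g \<Longrightarrow> \<exists>c. v = lincomb sc (r (reg0 g)) c (z g)"
    and z_act: "h - g \<in> Gp \<Longrightarrow> s < r (reg0 g) \<Longrightarrow>
      act g h (z g s) = lincomb sc (r (reg0 h)) (\<lambda>t. C (reg0 g) (reg0 h) t s) (z h)"
    and M: "M > 0"
    and reg: "S \<subseteq> {..<length as} \<Longrightarrow>
      \<forall>\<^sub>F l in sequentially. reg0 (g + nmul (l * M) (degS as S)) = reg g S"
begin

section \<open>Linear algebra in the graded pieces\<close>

lemma V_0: "0 \<in> V g" and V_add: "x \<in> V g \<Longrightarrow> y \<in> V g \<Longrightarrow> x + y \<in> V g"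
  and V_scale: "x \<in> V g \<Longrightarrow> sc c x \<in> V g"
  using gm unfolding gmodule_def by blast+

lemma act_V: "h - g \<in> Gp \<Longrightarrow> x \<in> V g \<Longrightarrow> act g h x \<in> V h"
  and act_add: "h - g \<in> Gp \<Longrightarrow> x \<in> V g \<Longrightarrow> y \<in> V g \<Longrightarrow> act g h (x + y) = act g h x + act g h y"
  and act_scale: "h - g \<in> Gp \<Longrightarrow> x \<in> V g \<Longrightarrow> act g h (sc c x) = sc c (act g h x)"
  and act_id: "x \<in> V g \<Longrightarrow> act g g x = x"
  and act_comp: "h - g \<in> Gp \<Longrightarrow> k - h \<in> Gp \<Longrightarrow> x \<in> V g \<Longrightarrow> act h k (act g h x) = act g k x"
  using gm unfolding gmodule_def by blast+

lemma subspace_V: "subspace (V g)"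
  by (rule subspaceI) (auto intro: V_0 V_add V_scale)

lemma act_0: "h - g \<in> Gp \<Longrightarrow> act g h 0 = 0"
  using act_add[of h g 0 0] V_0 by simp

lemma act_sum: "h - g \<in> Gp \<Longrightarrow> (\<And>x. x \<in> X \<Longrightarrow> f x \<in> V g) \<Longrightarrow> act g h (\<Sum>x\<in>X. f x) = (\<Sum>x\<in>X. act g h (f x))"
proof (induction X rule: infinite_finite_induct)
  case (insert x F)
  then show ?case by (simp add: act_add subspace_sum[OF subspace_V])
qed (simp_all add: act_0)

abbreviation lc :: "'z \<times> 'q \<Rightarrow> (nat \<Rightarrow> 'k) \<Rightarrow> 'v" where
  "lc g c \<equiv> lincomb sc (r (reg0 g)) c (z g)"

lemma lc_V: "lc g c \<in> V g"
  unfolding lincomb_def using z_V by (intro subspace_sum[OF subspace_V] V_scale) auto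

lemma lincomb_add: "lincomb sc n (\<lambda>s. c s + c' s) y = lincomb sc n c y + lincomb sc n c' y"
  by (simp add: lincomb_def scale_left_distrib sum.distrib)

lemma lincomb_diff: "lincomb sc n (\<lambda>s. c s - c' s) y = lincomb sc n c y - lincomb sc n c' y"
  by (simp add: lincomb_def scale_left_diff_distrib sum_subtractf)

lemma lincomb_scale: "lincomb sc n (\<lambda>s. a * c s) y = sc a (lincomb sc n c y)"
  by (simp add: lincomb_def scale_sum_right)

lemma lincomb_sum: "lincomb sc n (\<lambda>s. \<Sum>x\<in>X. c x s) y = (\<Sum>x\<in>X. lincomb sc n (c x) y)"
  unfolding lincomb_def scale_sum_left by (rule sum.swap)

lemma lc_eqD: "lc g c = lc g c' \<Longrightarrow> s < r (reg0 g) \<Longrightarrow> c s = c' s"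
  using z_indep[of g "\<lambda>s. c s - c' s" s] by (simp add: lincomb_diff)

text \<open>Cut off at \<open>r J\<close>, because coordinate vectors are functions on all naturals
  and become unique only by vanishing beyond the dimension.\<close>

definition cmat :: "nat \<Rightarrow> nat \<Rightarrow> (nat \<Rightarrow> 'k) \<Rightarrow> nat \<Rightarrow> 'k" where
  "cmat I J c t = (if t < r J then \<Sum>s<r I. C I J t s * c s else 0)"

lemma act_lc:
  assumes "h - g \<in> Gp" shows "act g h (lc g c) = lc h (cmat (reg0 g) (reg0 h) c)"
proof -
  have "act g h (lc g c) = (\<Sum>s<r (reg0 g). sc (c s) (lc h (\<lambda>t. C (reg0 g) (reg0 h) t s)))"
    unfolding lincomb_def[of _ "r (reg0 g)"] using assms z_V
    by (subst act_sum) (auto simp: V_scale act_scale z_act)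
  also have "\<dots> = lc h (\<lambda>t. \<Sum>s<r (reg0 g). c s * C (reg0 g) (reg0 h) t s)"
    by (simp add: lincomb_sum lincomb_scale)
  also have "\<dots> = lc h (cmat (reg0 g) (reg0 h) c)"
    by (rule lincomb_cong) (simp add: cmat_def mult.commute)
  finally show ?thesis .
qed

text \<open>Identity maps being among the comparison maps, the matrix attached to a single region
  is the identity.\<close>

lemma act_lc_same:
  assumes "h - g \<in> Gp" "reg0 h = reg0 g" shows "act g h (lc g c) = lc h c"
proof -
  have "lc g (cmat (reg0 g) (reg0 g) c) = lc g c"
    using act_lc[of g g c] act_id[OF lc_V] Gp_0 by simp
  then have "cmat (reg0 g) (reg0 g) c s = c s" if "s < r (reg0 g)" for s
    using lc_eqD that by blast
  then show ?thesis unfolding act_lc[OF assms(1)] assms(2)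
    by (intro lincomb_cong)
qed

section \<open>Coordinates of fractions in a localization\<close>

definition pt :: "nat set \<Rightarrow> 'z \<times> 'q \<Rightarrow> nat \<Rightarrow> 'z \<times> 'q" where
  "pt S g k = g + nmul k (degS as S)"

lemma nmul_Gp: "a \<in> Gp \<Longrightarrow> nmul k a \<in> Gp"
  by (induction k) (auto simp: Gp_0 Gp_add)

lemma degS_Gp: "S \<subseteq> {..<length as} \<Longrightarrow> degS as S \<in> Gp"
  using degS_diff[of "{}" S] by (simp add: degS_def zero_prod_def[symmetric])

text \<open>The difference is a sum of three cone elements: one for raising the degree from
  \<open>g\<close> to \<open>h\<close>, one for enlarging the denominator from \<open>S\<close> to
  \<open>T\<close> at exponent \<open>k\<close>, one for raising the exponent to
  \<open>l\<close>.\<close>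

lemma pt_le:
  assumes "S \<subseteq> T" "T \<subseteq> {..<length as}" "h - g \<in> Gp" "k \<le> l"
  shows "pt T h l - pt S g k \<in> Gp"
proof -
  have "pt T h l - pt S g k = (h - g) + (nmul k (degS as T - degS as S) + nmul (l - k) (degS as T))"
    using assms(4) by (simp add: pt_def nmul_diff nmul_diff_right algebra_simps)
  then show ?thesis using assms degS_diff degS_Gp by (auto intro!: Gp_add nmul_Gp)
qed

lemma pt_mono: "S \<subseteq> {..<length as} \<Longrightarrow> k \<le> l \<Longrightarrow> pt S g l - pt S g k \<in> Gp"
  using pt_le[of S S g g k l] Gp_0 by simp

text \<open>A numerator \<open>v\<close> in degree \<open>pt S g k\<close> stands for a fraction of
  degree \<open>g\<close>. Its coordinates \<open>c\<close> are read off far out on the ray, after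
  expanding the fraction to exponent \<open>l * M\<close>, where the numerator lies in the eventual
  region.\<close>

definition rep :: "'z \<times> 'q \<Rightarrow> nat set \<Rightarrow> nat \<Rightarrow> 'v \<Rightarrow> (nat \<Rightarrow> 'k) \<Rightarrow> bool" where
  "rep g S k v c \<longleftrightarrow> (\<forall>t\<ge>r (reg g S). c t = 0) \<and>
     (\<forall>\<^sub>F l in sequentially. k \<le> l * M \<and> reg0 (pt S g (l * M)) = reg g S \<and>
        act (pt S g k) (pt S g (l * M)) v = lc (pt S g (l * M)) c)"

lemma eventually_mult_M: "\<forall>\<^sub>F l in sequentially. k \<le> l * M"
  using eventually_ge_at_top[of k]
proof eventually_elim
  case (elim l)
  have "l * 1 \<le> l * M" using M by (intro mult_le_mono2) simp
  then show ?case using elim by linarith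
qed

text \<open>Maps inside one region preserve coordinates, so those found at the first stable index
  \<open>l0\<close> persist.\<close>

lemma rep_ex:
  assumes S: "S \<subseteq> {..<length as}" and v: "v \<in> V (pt S g k)"
  shows "\<exists>c. rep g S k v c"
proof -
  have "\<forall>\<^sub>F l in sequentially. k \<le> l * M \<and> reg0 (pt S g (l * M)) = reg g S"
    using eventually_conj[OF eventually_mult_M reg[OF S]] by (simp add: pt_def)
  then obtain l0 where l0: "\<And>l. l \<ge> l0 \<Longrightarrow> k \<le> l * M \<and> reg0 (pt S g (l * M)) = reg g S"
    unfolding eventually_sequentially by blast
  let ?p = "\<lambda>l. pt S g (l * M)"
  have kp: "?p l - pt S g k \<in> Gp" if "l \<ge> l0" for l using pt_mono[OF S] l0 that by blast
  obtain c where c: "act (pt S g k) (?p l0) v = lc (?p l0) c"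
    using z_span[OF act_V[OF kp[OF order_refl] v]] by blast
  define c' where "c' t = (if t < r (reg g S) then c t else 0)" for t
  have c': "act (pt S g k) (?p l0) v = lc (?p l0) c'"
    unfolding c using l0[of l0] by (intro lincomb_cong) (simp add: c'_def)
  have "act (pt S g k) (?p l) v = lc (?p l) c'" if l: "l \<ge> l0" for l
  proof -
    have le: "?p l - ?p l0 \<in> Gp" using l by (intro pt_mono[OF S]) simp
    have "act (pt S g k) (?p l) v = act (?p l0) (?p l) (act (pt S g k) (?p l0) v)"
      using act_comp[OF kp le v] by simp
    also have "\<dots> = lc (?p l) c'" unfolding c' using l0 l by (intro act_lc_same[OF le]) simp
    finally show ?thesis .
  qed
  then have "rep g S k v c'" unfolding rep_def eventually_sequentially
    using l0 by (intro conjI exI[of _ l0]) (auto simp: c'_def)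
  then show ?thesis by blast
qed

lemma rep_unique:
  assumes "rep g S k v c" "rep g S k v c'" shows "c = c'"
proof
  fix t
  show "c t = c' t"
  proof (cases "t < r (reg g S)")
    case True
    have "\<forall>\<^sub>F l in sequentially. c t = c' t"
      using assms[unfolded rep_def, THEN conjunct2]
      by eventually_elim (metis True lc_eqD)
    then show ?thesis by simp
  next
    case False
    then show ?thesis using assms unfolding rep_def by simp
  qed
qed

definition coord :: "'z \<times> 'q \<Rightarrow> nat set \<Rightarrow> nat \<Rightarrow> 'v \<Rightarrow> nat \<Rightarrow> 'k" where
  "coord g S k v = (THE c. rep g S k v c)"

lemma coord_eqI: "rep g S k v c \<Longrightarrow> coord g S k v = c"
  unfolding coord_def using rep_unique by blast

lemma rep_coord: "S \<subseteq> {..<length as} \<Longrightarrow> v \<in> V (pt S g k) \<Longrightarrow> rep g S k v (coord g S k v)"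
  using rep_ex coord_eqI by metis

lemma coord_outside: "S \<subseteq> {..<length as} \<Longrightarrow> v \<in> V (pt S g k) \<Longrightarrow> t \<ge> r (reg g S) \<Longrightarrow> coord g S k v t = 0"
  using rep_coord unfolding rep_def by blast

text \<open>The case \<open>g = h\<close> gives the components of the Cech differential, the case \<open>S = T\<close> the
  action of a monomial on one localization.\<close>

lemma rep_act:
  assumes ST: "S \<subseteq> T" "T \<subseteq> {..<length as}" and gh: "h - g \<in> Gp" and v: "v \<in> V (pt S g k)"
    and rep: "rep g S k v c"
  shows "rep h T k (act (pt S g k) (pt T h k) v) (cmat (reg g S) (reg h T) c)"
  unfolding rep_def
proof (intro conjI)
  have S: "S \<subseteq> {..<length as}" using ST by blast
  have "\<forall>\<^sub>F l in sequentially. reg0 (pt T h (l * M)) = reg h T" using reg[OF ST(2)] by (simp add: pt_def)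
  with rep[unfolded rep_def, THEN conjunct2]
  show "\<forall>\<^sub>F l in sequentially. k \<le> l * M \<and> reg0 (pt T h (l * M)) = reg h T \<and>
      act (pt T h k) (pt T h (l * M)) (act (pt S g k) (pt T h k) v) =
      lc (pt T h (l * M)) (cmat (reg g S) (reg h T) c)"
  proof eventually_elim
    case (elim l)
    then have kl: "k \<le> l * M" by simp
    \<comment> \<open>Both ways around the square equal the direct map. The other way first goes far
      out along \<open>S\<close> in degree \<open>g\<close>, where the coordinates are known, and
      then crosses over with a single comparison matrix.\<close>
    have "act (pt T h k) (pt T h (l * M)) (act (pt S g k) (pt T h k) v) = act (pt S g k) (pt T h (l * M)) v"
      by (rule act_comp[OF pt_le[OF ST gh] pt_mono[OF ST(2) kl] v]) simp
    also have "\<dots> = act (pt S g (l * M)) (pt T h (l * M)) (act (pt S g k) (pt S g (l * M)) v)"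
      by (rule act_comp[OF pt_mono[OF S kl] pt_le[OF ST gh] v, symmetric]) simp
    also have "\<dots> = lc (pt T h (l * M)) (cmat (reg g S) (reg h T) c)"
      using elim act_lc[OF pt_le[OF ST gh order_refl], of "l * M" c] by simp
    finally show ?case using elim by simp
  qed
qed (simp add: cmat_def)

lemma coord_act:
  assumes ST: "S \<subseteq> T" "T \<subseteq> {..<length as}" and gh: "h - g \<in> Gp" and v: "v \<in> V (pt S g k)"
  shows "coord h T k (act (pt S g k) (pt T h k) v) = cmat (reg g S) (reg h T) (coord g S k v)"
  using assms by (intro coord_eqI rep_act rep_coord) auto

text \<open>Expanding a fraction by the monomial of \<open>S\<close> does not change it; these are
  the relations that span \<open>cechR\<close>.\<close>

lemma coord_Suc:
  assumes S: "S \<subseteq> {..<length as}" and v: "v \<in> V (pt S g k)"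
  shows "coord g S (Suc k) (act (pt S g k) (pt S g (Suc k)) v) = coord g S k v"
proof (rule coord_eqI, unfold rep_def, intro conjI)
  show "\<forall>t\<ge>r (reg g S). coord g S k v t = 0" using coord_outside[OF assms] by blast
  show "\<forall>\<^sub>F l in sequentially. Suc k \<le> l * M \<and> reg0 (pt S g (l * M)) = reg g S \<and>
      act (pt S g (Suc k)) (pt S g (l * M)) (act (pt S g k) (pt S g (Suc k)) v) = lc (pt S g (l * M)) (coord g S k v)"
    using rep_coord[OF assms, unfolded rep_def, THEN conjunct2] eventually_mult_M[of "Suc k"]
  proof eventually_elim
    case (elim l)
    then show ?case using act_comp[OF pt_mono[OF S] pt_mono[OF S] v, of "Suc k" "l * M"] by simp
  qed
qed

lemma coord_add:
  assumes S: "S \<subseteq> {..<length as}" and v: "v \<in> V (pt S g k)" "w \<in> V (pt S g k)"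
  shows "coord g S k (v + w) t = coord g S k v t + coord g S k w t"
proof -
  have "coord g S k (v + w) = (\<lambda>t. coord g S k v t + coord g S k w t)"
  proof (rule coord_eqI, unfold rep_def, intro conjI)
    show "\<forall>t\<ge>r (reg g S). coord g S k v t + coord g S k w t = 0"
      using coord_outside[OF S] v by simp
    show "\<forall>\<^sub>F l in sequentially. k \<le> l * M \<and> reg0 (pt S g (l * M)) = reg g S \<and>
        act (pt S g k) (pt S g (l * M)) (v + w) = lc (pt S g (l * M)) (\<lambda>t. coord g S k v t + coord g S k w t)"
      using rep_coord[OF S v(1), unfolded rep_def, THEN conjunct2] rep_coord[OF S v(2), unfolded rep_def, THEN conjunct2]
    proof eventually_elim
      case (elim l)
      then show ?case using act_add[OF pt_mono[OF S] v, of "l * M"] by (simp add: lincomb_add)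
    qed
  qed
  then show ?thesis by simp
qed

lemma coord_scale:
  assumes S: "S \<subseteq> {..<length as}" and v: "v \<in> V (pt S g k)"
  shows "coord g S k (sc a v) t = a * coord g S k v t"
proof -
  have "coord g S k (sc a v) = (\<lambda>t. a * coord g S k v t)"
  proof (rule coord_eqI, unfold rep_def, intro conjI)
    show "\<forall>t\<ge>r (reg g S). a * coord g S k v t = 0"
      using coord_outside[OF S] v by simp
    show "\<forall>\<^sub>F l in sequentially. k \<le> l * M \<and> reg0 (pt S g (l * M)) = reg g S \<and>
        act (pt S g k) (pt S g (l * M)) (sc a v) = lc (pt S g (l * M)) (\<lambda>t. a * coord g S k v t)"
      using rep_coord[OF S v, unfolded rep_def, THEN conjunct2]
    proof eventually_elim
      case (elim l)
      then show ?case using act_scale[OF pt_mono[OF S] v, of "l * M"] by (simp add: lincomb_scale)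
    qed
  qed
  then show ?thesis by simp
qed

lemma coord_0: "S \<subseteq> {..<length as} \<Longrightarrow> coord g S k 0 t = 0"
  using coord_scale[of S 0 g k 0 t] V_0 by simp

lemma coord_sum:
  assumes S: "S \<subseteq> {..<length as}" and "\<And>x. x \<in> X \<Longrightarrow> f x \<in> V (pt S g k)"
  shows "coord g S k (\<Sum>x\<in>X. f x) t = (\<Sum>x\<in>X. coord g S k (f x) t)"
  using assms(2)
proof (induction X rule: infinite_finite_induct)
  case (insert x F)
  then show ?case by (simp add: coord_add[OF S] subspace_sum[OF subspace_V])
qed (simp_all add: coord_0[OF S])

text \<open>A vector placed at exponent \<open>l0 * M\<close>, beyond which the region no longer
  changes, keeps its coordinates under all later maps.\<close>

lemma coord_surj:
  assumes S: "S \<subseteq> {..<length as}" and c: "\<forall>t\<ge>r (reg g S). c t = 0"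
  shows "\<exists>k. \<exists>v\<in>V (pt S g k). coord g S k v = c"
proof -
  obtain l0 where l0: "\<And>l. l \<ge> l0 \<Longrightarrow> reg0 (pt S g (l * M)) = reg g S"
    using reg[OF S] unfolding eventually_sequentially pt_def by blast
  let ?v = "lc (pt S g (l0 * M)) c"
  have "rep g S (l0 * M) ?v c"
    unfolding rep_def eventually_sequentially
  proof (intro conjI exI[of _ l0] allI impI)
    fix l assume l: "l0 \<le> l"
    then show "l0 * M \<le> l * M" by simp
    then show "act (pt S g (l0 * M)) (pt S g (l * M)) ?v = lc (pt S g (l * M)) c"
      using l0 l by (intro act_lc_same pt_mono[OF S]) simp_all
    show "reg0 (pt S g (l * M)) = reg g S" using l0 l by blast
  qed (use c in blast)
  then show ?thesis using lc_V coord_eqI by blast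
qed


section \<open>Cech cochains and their evaluation in the localizations\<close>

abbreviation F where "F \<equiv> cechF V as"
abbreviation R where "R \<equiv> cechR sc V act as"
abbreviation d where "d \<equiv> cechd sc act as"

lemma valid_subset: "cech_valid as i S \<Longrightarrow> S \<subseteq> {..<length as}"
  by (simp add: cech_valid_def)

lemma F_iff: "f \<in> F i g \<longleftrightarrow> finite {x. f x \<noteq> 0} \<and>
     (\<forall>S k. if cech_valid as i S then f (S, k) \<in> V (pt S g k) else f (S, k) = 0)"
  by (simp add: cechF_def pt_def)

lemma F_V: "f \<in> F i g \<Longrightarrow> f (S, k) \<in> V (pt S g k)"
  using V_0 unfolding F_iff by (metis (full_types))

sublocale ms: vector_space "fsc sc"
  by (rule vector_space_fsc) unfold_locales

lemma subspace_F: "ms.subspace (F i g)"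
proof (rule ms.subspaceI)
  show "0 \<in> F i g" by (simp add: F_iff V_0)
next
  fix f f' assume f: "f \<in> F i g" "f' \<in> F i g"
  have "{x. (f + f') x \<noteq> 0} \<subseteq> {x. f x \<noteq> 0} \<union> {x. f' x \<noteq> 0}" by auto
  then have "finite {x. (f + f') x \<noteq> 0}" using f by (auto simp: F_iff intro: finite_subset)
  then show "f + f' \<in> F i g" using f by (simp add: F_iff V_add)
next
  fix c f assume f: "f \<in> F i g"
  have "{x. fsc sc c f x \<noteq> 0} \<subseteq> {x. f x \<noteq> 0}" by (auto simp: fsc_def)
  then have "finite {x. fsc sc c f x \<noteq> 0}" using f by (auto simp: F_iff intro: finite_subset)
  then show "fsc sc c f \<in> F i g" using f by (auto simp: F_iff fsc_def V_scale)
qed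

lemma delta_F: "cech_valid as i S \<Longrightarrow> v \<in> V (pt S g k) \<Longrightarrow> delta (S, k) v \<in> F i g"
proof -
  assume "cech_valid as i S" "v \<in> V (pt S g k)"
  moreover have "{x. delta (S, k) v x \<noteq> 0} \<subseteq> {(S, k)}" by (auto simp: delta_def)
  then have "finite {x. delta (S, k) v x \<noteq> 0}" by (rule finite_subset) simp
  ultimately show ?thesis by (auto simp: F_iff delta_def V_0)
qed

lemma R_span: "R i g = ms.span {delta (S, k) v - delta (S, Suc k) (act (pt S g k) (pt S g (Suc k)) v) | S k v.
       cech_valid as i S \<and> v \<in> V (pt S g k)}"
  unfolding cechR_def pt_def by (rule span_sc_eq_span) (rule ms.vector_space_axioms)

text \<open>Evaluation of a formal sum of fractions: for each \<open>S\<close>, the fractions with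
  different exponents \<open>k\<close> are added in the localization at \<open>S\<close>.\<close>

definition emap :: "'z \<times> 'q \<Rightarrow> (nat set \<times> nat \<Rightarrow> 'v) \<Rightarrow> (nat set \<times> nat \<Rightarrow> 'k)" where
  "emap g f = (\<lambda>(S, t). \<Sum>k | f (S, k) \<noteq> 0. coord g S k (f (S, k)) t)"

lemma F_finite_snd: "f \<in> F i g \<Longrightarrow> finite {k. \<exists>S. f (S, k) \<noteq> 0}"
proof -
  assume "f \<in> F i g"
  then have "finite (snd ` {x. f x \<noteq> 0})" by (simp add: F_iff)
  moreover have "snd ` {x. f x \<noteq> 0} = {k. \<exists>S. f (S, k) \<noteq> 0}" by force
  ultimately show ?thesis by simp
qed

text \<open>Families with different supports become comparable once their sums run over one finite
  set of exponents.\<close>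

lemma emap_eq:
  assumes "S \<subseteq> {..<length as}" "finite K" "{k. f (S, k) \<noteq> 0} \<subseteq> K"
  shows "emap g f (S, t) = (\<Sum>k\<in>K. coord g S k (f (S, k)) t)"
  unfolding emap_def using assms by (auto intro!: sum.mono_neutral_left simp: coord_0)

lemma emap_invalid: "f \<in> F i g \<Longrightarrow> \<not> cech_valid as i S \<Longrightarrow> emap g f (S, t) = 0"
  by (simp add: emap_def F_iff)

lemma emap_add:
  assumes "f \<in> F i g" "f' \<in> F i g" shows "emap g (f + f') = emap g f + emap g f'"
proof (rule ext, clarify)
  fix S t
  show "emap g (f + f') (S, t) = (emap g f + emap g f') (S, t)"
  proof (cases "cech_valid as i S")
    case True
    note S = valid_subset[OF True]
    let ?K = "{k. \<exists>S. f (S, k) \<noteq> 0} \<union> {k. \<exists>S. f' (S, k) \<noteq> 0}"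
    have "finite ?K" using assms F_finite_snd by blast
    then have "emap g h (S, t) = (\<Sum>k\<in>?K. coord g S k (h (S, k)) t)" if "h \<in> {f, f', f + f'}" for h
      using that by (intro emap_eq[OF S]) auto
    then show ?thesis using F_V assms by (simp add: coord_add[OF S] sum.distrib)
  next
    case False
    then show ?thesis using assms ms.subspace_add[OF subspace_F assms] by (simp add: emap_invalid)
  qed
qed

lemma emap_scale:
  assumes "f \<in> F i g" shows "emap g (fsc sc a f) = fsc (*) a (emap g f)"
proof (rule ext, clarify)
  fix S t
  show "emap g (fsc sc a f) (S, t) = fsc (*) a (emap g f) (S, t)"
  proof (cases "cech_valid as i S")
    case True
    note S = valid_subset[OF True]
    let ?K = "{k. \<exists>S. f (S, k) \<noteq> 0}"
    have "finite ?K" using assms F_finite_snd by blast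
    then have "emap g h (S, t) = (\<Sum>k\<in>?K. coord g S k (h (S, k)) t)" if "h \<in> {f, fsc sc a f}" for h
      using that by (intro emap_eq[OF S]) (auto simp: fsc_def)
    then show ?thesis using F_V assms by (simp add: fsc_def coord_scale[OF S] sum_distrib_left)
  next
    case False
    then show ?thesis
      using emap_invalid[OF ms.subspace_scale[OF subspace_F assms, of a] False] emap_invalid[OF assms False]
      by (simp add: fsc_def[of "(*)"])
  qed
qed

lemma emap_0 [simp]: "emap g 0 = 0"
  by (auto simp: emap_def)

lemma emap_sum:
  assumes "\<And>x. x \<in> X \<Longrightarrow> f x \<in> F i g" shows "emap g (\<Sum>x\<in>X. f x) = (\<Sum>x\<in>X. emap g (f x))"
  using assms
proof (induction X rule: infinite_finite_induct)
  case (insert x X)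
  have "(\<Sum>x\<in>X. f x) \<in> F i g" using insert.prems by (intro ms.subspace_sum[OF subspace_F]) simp
  then have "emap g (f x + (\<Sum>x\<in>X. f x)) = emap g (f x) + emap g (\<Sum>x\<in>X. f x)"
    using insert.prems by (intro emap_add[of _ i]) simp_all
  moreover have "emap g (\<Sum>x\<in>X. f x) = (\<Sum>x\<in>X. emap g (f x))" using insert by simp
  ultimately show ?case by (simp only: sum.insert[OF insert.hyps])
qed simp_all

lemma emap_delta:
  assumes S: "S \<subseteq> {..<length as}"
  shows "emap g (delta (S, k) v) = (\<lambda>(T, t). if T = S then coord g S k v t else 0)"
proof (rule ext, clarify)
  fix T t
  show "emap g (delta (S, k) v) (T, t) = (if T = S then coord g S k v t else 0)"
  proof (cases "T = S")
    case True
    have "emap g (delta (S, k) v) (S, t) = (\<Sum>k\<in>{k}. coord g S k (delta (S, k) v (S, k)) t)"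
      by (subst emap_eq[OF S, of "{k}"]) (auto simp: delta_def split: if_splits)
    then show ?thesis using True by (simp add: delta_def)
  next
    case False
    then show ?thesis by (simp add: emap_def delta_def)
  qed
qed

sublocale km: vector_space "fsc (*) :: 'k \<Rightarrow> (nat set \<times> nat \<Rightarrow> 'k) \<Rightarrow> _"
  by (rule vector_space_fsc) (unfold_locales, auto simp: algebra_simps)

lemma R_subset: "R i g \<subseteq> {f \<in> F i g. emap g f = 0}"
  unfolding R_span
proof (rule ms.span_minimal)
  show "ms.subspace {f \<in> F i g. emap g f = 0}"
    using subspace_F[of i g] unfolding ms.subspace_def by (auto simp: emap_add[of _ i] emap_scale[of _ i])
next
  show "{delta (S, k) v - delta (S, Suc k) (act (pt S g k) (pt S g (Suc k)) v) | S k v.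
       cech_valid as i S \<and> v \<in> V (pt S g k)} \<subseteq> {f \<in> F i g. emap g f = 0}"
  proof clarify
    fix S k v assume S: "cech_valid as i S" and v: "v \<in> V (pt S g k)"
    note S' = valid_subset[OF S]
    let ?w = "act (pt S g k) (pt S g (Suc k)) v"
    have w: "?w \<in> V (pt S g (Suc k))" using pt_mono[OF S'] v by (intro act_V) auto
    have D: "delta (S, k) v \<in> F i g" "delta (S, Suc k) ?w \<in> F i g" using delta_F S v w by auto
    note D' = ms.subspace_diff[OF subspace_F D]
    have "emap g (delta (S, k) v - delta (S, Suc k) ?w) + emap g (delta (S, Suc k) ?w) = emap g (delta (S, k) v)"
      by (subst emap_add[OF D' D(2), symmetric]) simp
    moreover have "emap g (delta (S, Suc k) ?w) = emap g (delta (S, k) v)"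
      by (simp only: emap_delta[OF S'] coord_Suc[OF S' v])
    ultimately show "delta (S, k) v - delta (S, Suc k) ?w \<in> F i g \<and> emap g (delta (S, k) v - delta (S, Suc k) ?w) = 0"
      using D' by simp
  qed
qed

text \<open>Telescopes the one-step relations from exponent \<open>k\<close> to
  \<open>l\<close>.\<close>

lemma delta_shift:
  assumes S: "cech_valid as i S" and v: "v \<in> V (pt S g k)" and "k \<le> l"
  shows "delta (S, k) v - delta (S, l) (act (pt S g k) (pt S g l) v) \<in> R i g"
  using assms(3)
proof (induction l rule: dec_induct)
  case base
  show ?case by (simp only: act_id[OF v] diff_self R_span ms.span_zero)
next
  case (step l)
  note S' = valid_subset[OF S]
  let ?w = "act (pt S g k) (pt S g l) v"
  have w: "?w \<in> V (pt S g l)" using pt_mono[OF S' step(1)] v by (intro act_V) auto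
  have "act (pt S g k) (pt S g (Suc l)) v = act (pt S g l) (pt S g (Suc l)) ?w"
    using act_comp[OF pt_mono[OF S' step(1)] pt_mono[OF S', of l "Suc l"] v] by simp
  moreover have "delta (S, l) ?w - delta (S, Suc l) (act (pt S g l) (pt S g (Suc l)) ?w) \<in> R i g"
    unfolding R_span by (rule ms.span_base) (use S w in blast)
  ultimately have "(delta (S, k) v - delta (S, l) ?w) + (delta (S, l) ?w - delta (S, Suc l) (act (pt S g k) (pt S g (Suc l)) v)) \<in> R i g"
    using step.IH unfolding R_span by (intro ms.span_add) (simp_all only:)
  moreover have "(a - b) + (b - c) = a - c" for a b c :: "nat set \<times> nat \<Rightarrow> 'v"
    by (simp add: fun_eq_iff)
  ultimately show ?case by (simp only:)
qed

lemma sum_fun_apply: "(\<Sum>x\<in>X. f x) y = (\<Sum>x\<in>X. f x y)"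
  by (induction X rule: infinite_finite_induct) auto

text \<open>Modulo relations, the finitely many entries of \<open>f\<close> are moved to one
  exponent \<open>l * M\<close>, far enough out for all their coordinates to be visible. The sum
  that arises there at \<open>S\<close> has coordinates \<open>emap g f (S, t)\<close>, all zero, so
  nothing remains of \<open>f\<close> but relations.\<close>

lemma emap_kernel:
  assumes f: "f \<in> F i g" and 0: "emap g f = 0"
  shows "f \<in> R i g"
proof -
  let ?X = "{x. f x \<noteq> 0}"
  have fin: "finite ?X" using f by (simp add: F_iff)
  have valid: "cech_valid as i (fst x)" if "x \<in> ?X" for x
    using that f unfolding F_iff by (cases x) (metis (full_types) fst_conv mem_Collect_eq)
  have fV: "f x \<in> V (pt (fst x) g (snd x))" for x using F_V[OF f, of "fst x" "snd x"] by simp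
  have "\<forall>\<^sub>F l in sequentially. \<forall>x\<in>?X. snd x \<le> l * M \<and> reg0 (pt (fst x) g (l * M)) = reg g (fst x) \<and>
      act (pt (fst x) g (snd x)) (pt (fst x) g (l * M)) (f x) = lc (pt (fst x) g (l * M)) (coord g (fst x) (snd x) (f x))"
  proof (intro eventually_ball_finite fin ballI)
    fix x assume "x \<in> ?X"
    from rep_coord[OF valid_subset[OF valid[OF this]] fV]
    show "\<forall>\<^sub>F l in sequentially. snd x \<le> l * M \<and> reg0 (pt (fst x) g (l * M)) = reg g (fst x) \<and>
      act (pt (fst x) g (snd x)) (pt (fst x) g (l * M)) (f x) = lc (pt (fst x) g (l * M)) (coord g (fst x) (snd x) (f x))"
      unfolding rep_def by blast
  qed
  then obtain l where l: "\<And>x. x \<in> ?X \<Longrightarrow> snd x \<le> l * M" "\<And>x. x \<in> ?X \<Longrightarrow>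
      act (pt (fst x) g (snd x)) (pt (fst x) g (l * M)) (f x) = lc (pt (fst x) g (l * M)) (coord g (fst x) (snd x) (f x))"
    unfolding eventually_sequentially by blast
  let ?h = "\<Sum>x\<in>?X. delta (fst x, l * M) (act (pt (fst x) g (snd x)) (pt (fst x) g (l * M)) (f x))"
  have "f = (\<Sum>x\<in>?X. delta x (f x))"
    using fin by (auto simp: fun_eq_iff sum_fun_apply delta_def)
  then have "f - ?h = (\<Sum>x\<in>?X. delta x (f x) - delta (fst x, l * M) (act (pt (fst x) g (snd x)) (pt (fst x) g (l * M)) (f x)))"
    by (simp only: sum_subtractf)
  also have "\<dots> \<in> R i g"
  proof -
    have "delta x (f x) - delta (fst x, l * M) (act (pt (fst x) g (snd x)) (pt (fst x) g (l * M)) (f x)) \<in> R i g"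
      if "x \<in> ?X" for x
      using delta_shift[OF valid[OF that] fV l(1)[OF that]] by simp
    then show ?thesis unfolding R_span by (intro ms.span_sum)
  qed
  finally have fh: "f - ?h \<in> R i g" .
  have "?h (S, k) = 0" for S k
  proof (cases "k = l * M \<and> cech_valid as i S")
    case True
    then have S: "S \<subseteq> {..<length as}" using valid_subset by blast
    have "?h (S, k) = (\<Sum>x\<in>?X. if fst x = S then lc (pt S g k) (coord g (fst x) (snd x) (f x)) else 0)"
      unfolding sum_fun_apply by (rule sum.cong) (use l(2) True in \<open>auto simp: delta_def\<close>)
    also have "\<dots> = (\<Sum>x | x \<in> ?X \<and> fst x = S. lc (pt S g k) (coord g (fst x) (snd x) (f x)))"
      by (rule sum.inter_filter[OF fin, symmetric])
    also have "\<dots> = (\<Sum>j | f (S, j) \<noteq> 0. lc (pt S g k) (coord g S j (f (S, j))))"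
      by (rule sum.reindex_bij_witness[of _ "\<lambda>j. (S, j)" snd]) auto
    also have "\<dots> = lc (pt S g k) (\<lambda>t. emap g f (S, t))"
      by (simp add: emap_def lincomb_sum)
    also have "\<dots> = 0" by (simp add: 0 lincomb_def)
    finally show ?thesis .
  next
    case False
    then show ?thesis unfolding sum_fun_apply
      by (intro sum.neutral) (use valid in \<open>auto simp: delta_def\<close>)
  qed
  then have "?h = 0" by (auto simp: fun_eq_iff simp del: sum_fun_apply)
  then show ?thesis using fh by simp
qed

lemma R_eq: "R i g = {f \<in> F i g. emap g f = 0}"
  using R_subset emap_kernel by blast

section \<open>The matrix complex attached to a label\<close>

lemma cmat_add: "cmat I J (\<lambda>s. c s + c' s) t = cmat I J c t + cmat I J c' t"
  by (simp add: cmat_def distrib_left sum.distrib)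

lemma cmat_scale: "cmat I J (\<lambda>s. a * c s) t = a * cmat I J c t"
  by (simp add: cmat_def sum_distrib_left algebra_simps)

lemma cmat_0: "cmat I J (\<lambda>s. 0) t = 0"
  by (simp add: cmat_def)

lemma cmat_sum: "cmat I J (\<lambda>s. \<Sum>x\<in>X. c x s) t = (\<Sum>x\<in>X. cmat I J (c x) t)"
  by (induction X rule: infinite_finite_induct) (simp_all add: cmat_add cmat_0)

definition mspace :: "(nat set \<Rightarrow> nat) \<Rightarrow> nat \<Rightarrow> (nat set \<times> nat \<Rightarrow> 'k) set" where
  "mspace \<rho> i = {w. \<forall>S t. w (S, t) \<noteq> 0 \<longrightarrow> cech_valid as i S \<and> t < r (\<rho> S)}"

text \<open>The alternating sum of \<open>cechd\<close> with comparison matrices in place of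
  \<open>act\<close>; only the label \<open>\<rho>\<close> enters, not the degree.\<close>

definition mdiff :: "(nat set \<Rightarrow> nat) \<Rightarrow> nat \<Rightarrow> (nat set \<times> nat \<Rightarrow> 'k) \<Rightarrow> nat set \<times> nat \<Rightarrow> 'k" where
  "mdiff \<rho> i w = (\<lambda>(T, t). if cech_valid as (Suc i) T then
     (\<Sum>j\<in>T. (-1) ^ card {s \<in> T - {j}. s < j} * cmat (\<rho> (T - {j})) (\<rho> T) (\<lambda>s. w (T - {j}, s)) t) else 0)"

definition mact :: "(nat set \<Rightarrow> nat) \<Rightarrow> (nat set \<Rightarrow> nat) \<Rightarrow> (nat set \<times> nat \<Rightarrow> 'k) \<Rightarrow> nat set \<times> nat \<Rightarrow> 'k" where
  "mact \<rho> \<sigma> w = (\<lambda>(S, t). cmat (\<rho> S) (\<sigma> S) (\<lambda>s. w (S, s)) t)"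

lemma finite_valid: "finite {S. cech_valid as i S}"
  by (rule finite_subset[of _ "Pow {..<length as}"]) (auto simp: cech_valid_def)

lemma mdiff_add: "mdiff \<rho> i (w + w') = mdiff \<rho> i w + mdiff \<rho> i w'"
  by (auto simp: fun_eq_iff mdiff_def cmat_add distrib_left sum.distrib)

lemma mdiff_scale: "mdiff \<rho> i (fsc (*) a w) = fsc (*) a (mdiff \<rho> i w)"
  by (auto simp: fun_eq_iff mdiff_def cmat_scale fsc_def sum_distrib_left algebra_simps)

lemma mdiff_0: "mdiff \<rho> i 0 = 0"
  by (auto simp: fun_eq_iff mdiff_def cmat_0)

lemma subspace_mspace: "km.subspace (mspace \<rho> i)"
proof (rule km.subspaceI)
  fix w w' assume "w \<in> mspace \<rho> i" "w' \<in> mspace \<rho> i"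
  then show "w + w' \<in> mspace \<rho> i" unfolding mspace_def
    by simp (metis add_0)
qed (auto simp: mspace_def fsc_def)

lemma subspace_cocycles: "km.subspace {w \<in> mspace \<rho> i. mdiff \<rho> i w = 0}"
proof (rule km.subspaceI)
  show "0 \<in> {w \<in> mspace \<rho> i. mdiff \<rho> i w = 0}"
    using km.subspace_0[OF subspace_mspace] mdiff_0 by blast
next
  fix w w' assume "w \<in> {w \<in> mspace \<rho> i. mdiff \<rho> i w = 0}" "w' \<in> {w \<in> mspace \<rho> i. mdiff \<rho> i w = 0}"
  then have w: "w \<in> mspace \<rho> i" "w' \<in> mspace \<rho> i" "mdiff \<rho> i w = 0" "mdiff \<rho> i w' = 0" by blast+
  have "mdiff \<rho> i (w + w') = 0" by (simp only: mdiff_add w add_0)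
  then show "w + w' \<in> {w \<in> mspace \<rho> i. mdiff \<rho> i w = 0}"
    using km.subspace_add[OF subspace_mspace w(1,2)] by blast
next
  fix c w assume "w \<in> {w \<in> mspace \<rho> i. mdiff \<rho> i w = 0}"
  then have w: "w \<in> mspace \<rho> i" "mdiff \<rho> i w = 0" by blast+
  have "mdiff \<rho> i (fsc (*) c w) = 0" by (simp only: mdiff_scale w km.scale_zero_right)
  then show "fsc (*) c w \<in> {w \<in> mspace \<rho> i. mdiff \<rho> i w = 0}"
    using km.subspace_scale[OF subspace_mspace w(1)] by blast
qed

lemma subspace_mdiff_image: "km.subspace (mdiff \<rho> i ` mspace \<rho> i)"
proof (rule km.subspaceI)
  show "0 \<in> mdiff \<rho> i ` mspace \<rho> i"
    using imageI[OF km.subspace_0[OF subspace_mspace], of "mdiff \<rho> i"] by (simp only: mdiff_0)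
next
  fix x y assume "x \<in> mdiff \<rho> i ` mspace \<rho> i" "y \<in> mdiff \<rho> i ` mspace \<rho> i"
  then obtain w w' where w: "w \<in> mspace \<rho> i" "w' \<in> mspace \<rho> i" and xy: "x = mdiff \<rho> i w" "y = mdiff \<rho> i w'"
    by (elim imageE)
  show "x + y \<in> mdiff \<rho> i ` mspace \<rho> i"
    unfolding xy mdiff_add[symmetric] by (rule imageI[OF km.subspace_add[OF subspace_mspace w]])
next
  fix c x assume "x \<in> mdiff \<rho> i ` mspace \<rho> i"
  then obtain w where w: "w \<in> mspace \<rho> i" and x: "x = mdiff \<rho> i w" by (elim imageE)
  show "fsc (*) c x \<in> mdiff \<rho> i ` mspace \<rho> i"
    unfolding x mdiff_scale[symmetric] by (rule imageI[OF km.subspace_scale[OF subspace_mspace w]])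
qed

text \<open>Unit vectors; they are the finite spanning set from which finite dimension of cohomology
  is drawn.\<close>

definition mbasis :: "(nat set \<Rightarrow> nat) \<Rightarrow> nat \<Rightarrow> (nat set \<times> nat \<Rightarrow> 'k) set" where
  "mbasis \<rho> i = (\<lambda>x. delta x 1) ` (SIGMA S:{S. cech_valid as i S}. {..<r (\<rho> S)})"

lemma finite_mbasis: "finite (mbasis \<rho> i)"
  unfolding mbasis_def using finite_valid by auto

lemma mspace_span: "mspace \<rho> i \<subseteq> km.span (mbasis \<rho> i)"
proof
  fix w assume w: "w \<in> mspace \<rho> i"
  let ?X = "SIGMA S:{S. cech_valid as i S}. {..<r (\<rho> S)}"
  have fin: "finite ?X" using finite_valid by auto
  have "w x = (\<Sum>y\<in>?X. if x = y then w x else 0)" for x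
    using w fin by (cases x) (auto simp: mspace_def)
  moreover have "(\<Sum>y\<in>?X. fsc (*) (w y) (delta y 1)) x = (\<Sum>y\<in>?X. if x = y then w x else 0)" for x
    unfolding sum_fun_apply by (rule sum.cong) (auto simp: fsc_def delta_def)
  ultimately have "w = (\<Sum>y\<in>?X. fsc (*) (w y) (delta y 1))" by (intro ext) metis
  also have "\<dots> \<in> km.span (mbasis \<rho> i)"
    unfolding mbasis_def by (intro km.span_sum km.span_scale km.span_base) blast
  finally show "w \<in> km.span (mbasis \<rho> i)" .
qed

lemma emap_mspace:
  assumes "f \<in> F i g" shows "emap g f \<in> mspace (reg g) i"
  unfolding mspace_def
proof (intro CollectI allI impI)
  fix S t assume nz: "emap g f (S, t) \<noteq> 0"
  then have S: "cech_valid as i S" using emap_invalid[OF assms] by blast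
  moreover have "t < r (reg g S)"
  proof (rule ccontr)
    assume "\<not> t < r (reg g S)"
    then have "emap g f (S, t) = 0" unfolding emap_def
      using coord_outside[OF valid_subset[OF S] F_V[OF assms]] by simp
    then show False using nz by simp
  qed
  ultimately show "cech_valid as i S \<and> t < r (reg g S)" ..
qed

text \<open>Each component of \<open>w\<close> is realised by a single fraction, and these are
  summed over the finitely many valid \<open>S\<close>.\<close>

lemma emap_surj:
  assumes w: "w \<in> mspace (reg g) i" shows "w \<in> emap g ` F i g"
proof -
  have "\<exists>x. cech_valid as i S \<longrightarrow> snd x \<in> V (pt S g (fst x)) \<and> coord g S (fst x) (snd x) = (\<lambda>t. w (S, t))" for S
  proof (cases "cech_valid as i S")
    case True
    have "\<forall>t\<ge>r (reg g S). w (S, t) = 0" using w unfolding mspace_def by force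
    from coord_surj[OF valid_subset[OF True] this] show ?thesis by force
  qed simp
  then have "\<exists>x. \<forall>S. cech_valid as i S \<longrightarrow> snd (x S) \<in> V (pt S g (fst (x S))) \<and> coord g S (fst (x S)) (snd (x S)) = (\<lambda>t. w (S, t))"
    by (intro choice allI)
  then obtain x where x: "cech_valid as i S \<Longrightarrow> snd (x S) \<in> V (pt S g (fst (x S)))"
    "cech_valid as i S \<Longrightarrow> coord g S (fst (x S)) (snd (x S)) = (\<lambda>t. w (S, t))" for S by blast
  let ?V = "{S. cech_valid as i S}"
  let ?d = "\<lambda>S. delta (S, fst (x S)) (snd (x S))"
  have dF: "?d S \<in> F i g" if "S \<in> ?V" for S using that x delta_F by blast
  have "emap g (\<Sum>S\<in>?V. ?d S) = (\<Sum>S\<in>?V. emap g (?d S))" by (rule emap_sum[OF dF])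
  also have "\<dots> = w"
  proof (rule ext, clarify)
    fix T t
    have "(\<Sum>S\<in>?V. emap g (?d S)) (T, t) = (\<Sum>S\<in>?V. if T = S then w (T, t) else 0)"
      unfolding sum_fun_apply
      by (rule sum.cong) (use x valid_subset in \<open>auto simp: emap_delta\<close>)
    also have "\<dots> = w (T, t)" using w finite_valid by (auto simp: mspace_def)
    finally show "(\<Sum>S\<in>?V. emap g (?d S)) (T, t) = w (T, t)" .
  qed
  finally have "emap g (\<Sum>S\<in>?V. ?d S) = w" .
  moreover have "emap g (\<Sum>S\<in>?V. ?d S) \<in> emap g ` F i g"
    by (rule imageI) (intro ms.subspace_sum[OF subspace_F] dF)
  ultimately show ?thesis by (simp only:)
qed

section \<open>Differential and action in coordinates\<close>

lemma d_apply: "d i g f (T, k) = (if cech_valid as (Suc i) T then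
       (\<Sum>j\<in>T. sc ((-1) ^ card {s \<in> T - {j}. s < j}) (act (pt (T - {j}) g k) (pt T g k) (f (T - {j}, k)))) else 0)"
  by (simp add: cechd_def pt_def)

lemma pt_remove: "T \<subseteq> {..<length as} \<Longrightarrow> pt T g k - pt (T - {j}) g k \<in> Gp"
  using pt_le[of "T - {j}" T g g k k] Gp_0 by auto

text \<open>The differential does not mix exponents, which keeps the support of its values
  finite.\<close>

lemma d_zero: "(\<And>S. f (S, k) = 0) \<Longrightarrow> d i g f (T, k) = 0"
  using valid_subset[of "Suc i" T] by (simp add: d_apply act_0[OF pt_remove])

lemma d_F:
  assumes f: "f \<in> F i g" shows "d i g f \<in> F (Suc i) g"
  unfolding F_iff
proof (intro conjI allI)
  have "{x. d i g f x \<noteq> 0} \<subseteq> {T. cech_valid as (Suc i) T} \<times> {k. \<exists>S. f (S, k) \<noteq> 0}"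
  proof clarify
    fix T k assume nz: "d i g f (T, k) \<noteq> 0"
    then have "cech_valid as (Suc i) T" by (metis d_apply)
    moreover have "\<exists>S. f (S, k) \<noteq> 0" using nz d_zero by blast
    ultimately show "T \<in> {T. cech_valid as (Suc i) T} \<and> k \<in> {k. \<exists>S. f (S, k) \<noteq> 0}" by simp
  qed
  then show "finite {x. d i g f x \<noteq> 0}"
    by (rule finite_subset) (use finite_valid F_finite_snd[OF f] in auto)
next
  fix T k
  show "if cech_valid as (Suc i) T then d i g f (T, k) \<in> V (pt T g k) else d i g f (T, k) = 0"
    using valid_subset[of "Suc i" T] F_V[OF f]
    by (auto simp: d_apply intro!: subspace_sum[OF subspace_V] V_scale act_V pt_remove)
qed

text \<open>Passing from \<open>T - {j}\<close> to \<open>T\<close> is a comparison inside one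
  degree, so each summand is given by a matrix that depends on \<open>reg g\<close> only; exchanging
  the sums over \<open>k\<close> and \<open>j\<close> leaves the matrix differential.\<close>

lemma emap_d:
  assumes f: "f \<in> F i g" shows "emap g (d i g f) = mdiff (reg g) i (emap g f)"
proof (rule ext, clarify)
  fix T t
  show "emap g (d i g f) (T, t) = mdiff (reg g) i (emap g f) (T, t)"
  proof (cases "cech_valid as (Suc i) T")
    case True
    note T = valid_subset[OF True]
    let ?K = "{k. \<exists>S. f (S, k) \<noteq> 0}"
    let ?e = "\<lambda>j. (-1) ^ card {s \<in> T - {j}. s < j} :: 'k"
    note K = F_finite_snd[OF f]
    have A: "act (pt (T - {j}) g k) (pt T g k) (f (T - {j}, k)) \<in> V (pt T g k)" for j k
      by (rule act_V[OF pt_remove[OF T] F_V[OF f]])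
    have coord: "coord g T k (act (pt (T - {j}) g k) (pt T g k) (f (T - {j}, k))) =
        cmat (reg g (T - {j})) (reg g T) (coord g (T - {j}) k (f (T - {j}, k)))" for j k
      by (rule coord_act[OF _ T _ F_V[OF f]]) (use Gp_0 in auto)
    have "emap g (d i g f) (T, t) = (\<Sum>k\<in>?K. coord g T k (d i g f (T, k)) t)"
      by (rule emap_eq[OF T K]) (use d_zero in blast)
    also have "\<dots> = (\<Sum>k\<in>?K. \<Sum>j\<in>T. ?e j * cmat (reg g (T - {j})) (reg g T) (coord g (T - {j}) k (f (T - {j}, k))) t)"
      using True A by (intro sum.cong refl) (simp add: d_apply coord_sum[OF T] V_scale coord_scale[OF T] coord)
    also have "\<dots> = (\<Sum>j\<in>T. \<Sum>k\<in>?K. ?e j * cmat (reg g (T - {j})) (reg g T) (coord g (T - {j}) k (f (T - {j}, k))) t)"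
      by (rule sum.swap)
    also have "\<dots> = (\<Sum>j\<in>T. ?e j * cmat (reg g (T - {j})) (reg g T) (\<lambda>s. emap g f (T - {j}, s)) t)"
    proof (rule sum.cong[OF refl])
      fix j assume "j \<in> T"
      have "emap g f (T - {j}, s) = (\<Sum>k\<in>?K. coord g (T - {j}) k (f (T - {j}, k)) s)" for s
        by (rule emap_eq) (use T K in auto)
      then show "(\<Sum>k\<in>?K. ?e j * cmat (reg g (T - {j})) (reg g T) (coord g (T - {j}) k (f (T - {j}, k))) t) =
          ?e j * cmat (reg g (T - {j})) (reg g T) (\<lambda>s. emap g f (T - {j}, s)) t"
        by (simp add: cmat_sum sum_distrib_left)
    qed
    finally show ?thesis using True by (simp add: mdiff_def)
  next
    case False
    then show ?thesis using emap_invalid[OF d_F[OF f] False] by (simp add: mdiff_def)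
  qed
qed

lemma pt_diff: "pt S h k - pt S g k = h - g"
  by (simp add: pt_def)

lemma cech_act_apply: "cech_act act as g h f (S, k) = act (pt S g k) (pt S h k) (f (S, k))"
  by (simp add: cech_act_def pt_def)

lemma cech_act_F:
  assumes gh: "h - g \<in> Gp" and f: "f \<in> F i g" shows "cech_act act as g h f \<in> F i h"
  unfolding F_iff
proof (intro conjI allI)
  have z: "cech_act act as g h f (S, k) = 0" if "f (S, k) = 0" for S k
    using that gh by (simp add: cech_act_apply act_0 pt_diff)
  then have "{x. cech_act act as g h f x \<noteq> 0} \<subseteq> {x. f x \<noteq> 0}" by auto
  then show "finite {x. cech_act act as g h f x \<noteq> 0}" using f finite_subset unfolding F_iff by blast
  show "if cech_valid as i S then cech_act act as g h f (S, k) \<in> V (pt S h k) else cech_act act as g h f (S, k) = 0"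
    for S k
    using f z act_V[OF _ F_V[OF f]] gh by (auto simp: cech_act_apply pt_diff F_iff)
qed

lemma emap_cech_act:
  assumes gh: "h - g \<in> Gp" and f: "f \<in> F i g"
  shows "emap h (cech_act act as g h f) = mact (reg g) (reg h) (emap g f)"
proof (rule ext, clarify)
  fix S t
  note cf = cech_act_F[OF gh f]
  show "emap h (cech_act act as g h f) (S, t) = mact (reg g) (reg h) (emap g f) (S, t)"
  proof (cases "cech_valid as i S")
    case True
    note S = valid_subset[OF True]
    let ?K = "{k. \<exists>S. f (S, k) \<noteq> 0}"
    note K = F_finite_snd[OF f]
    have e: "emap g f (S, s) = (\<Sum>k\<in>?K. coord g S k (f (S, k)) s)" for s
      by (rule emap_eq[OF S K]) auto
    have "emap h (cech_act act as g h f) (S, t) = (\<Sum>k\<in>?K. coord h S k (cech_act act as g h f (S, k)) t)"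
    proof (rule emap_eq[OF S K], rule subsetI)
      fix k assume "k \<in> {k. cech_act act as g h f (S, k) \<noteq> 0}"
      then have "f (S, k) \<noteq> 0" using act_0[of "pt S h k" "pt S g k"] gh by (auto simp: cech_act_apply pt_diff)
      then show "k \<in> ?K" by blast
    qed
    also have "\<dots> = (\<Sum>k\<in>?K. cmat (reg g S) (reg h S) (coord g S k (f (S, k))) t)"
      by (simp add: cech_act_apply coord_act[OF subset_refl S gh F_V[OF f]])
    finally show ?thesis by (simp add: mact_def e cmat_sum)
  next
    case False
    then show ?thesis using emap_invalid[OF cf False] emap_invalid[OF f False] by (simp add: mact_def cmat_0)
  qed
qed

text \<open>Summand by summand, both sides factor the same direct map from \<open>T - {j}\<close> in
  degree \<open>g\<close> to \<open>T\<close> in degree \<open>h\<close>.\<close>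

lemma d_cech_act:
  assumes gh: "h - g \<in> Gp" and f: "f \<in> F i g"
  shows "d i h (cech_act act as g h f) = cech_act act as g h (d i g f)"
proof (rule ext, clarify)
  fix T k
  show "d i h (cech_act act as g h f) (T, k) = cech_act act as g h (d i g f) (T, k)"
  proof (cases "cech_valid as (Suc i) T")
    case True
    note T = valid_subset[OF True]
    have gh': "pt S h k - pt S g k \<in> Gp" for S using gh by (simp add: pt_diff)
    have A: "act (pt (T - {j}) g k) (pt T g k) (f (T - {j}, k)) \<in> V (pt T g k)" for j
      by (rule act_V[OF pt_remove[OF T] F_V[OF f]])
    have "act (pt (T - {j}) h k) (pt T h k) (act (pt (T - {j}) g k) (pt (T - {j}) h k) (f (T - {j}, k))) =
      act (pt T g k) (pt T h k) (act (pt (T - {j}) g k) (pt T g k) (f (T - {j}, k)))" for j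
      using act_comp[OF gh' pt_remove[OF T] F_V[OF f]] act_comp[OF pt_remove[OF T] gh' F_V[OF f]] by simp
    then show ?thesis using True A
      by (simp add: d_apply cech_act_apply act_sum[OF gh'] V_scale act_scale[OF gh'])
  next
    case False
    then show ?thesis using gh by (simp add: d_apply cech_act_apply act_0 pt_diff)
  qed
qed

text \<open>The differential of \<open>f\<close> is a relation iff its evaluation vanishes, and
  evaluation commutes with the differential.\<close>

lemma cechZ_eq: "cechZ sc V act as i g = {f \<in> F i g. emap g f \<in> {w \<in> mspace (reg g) i. mdiff (reg g) i w = 0}}"
proof (rule set_eqI)
  fix f
  show "f \<in> cechZ sc V act as i g \<longleftrightarrow> f \<in> {f \<in> F i g. emap g f \<in> {w \<in> mspace (reg g) i. mdiff (reg g) i w = 0}}"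
  proof (cases "f \<in> F i g")
    case True
    then show ?thesis using d_F[OF True] emap_mspace[OF True]
      by (simp only: cechZ_def R_eq mem_Collect_eq emap_d[OF True] simp_thms)
  qed (simp add: cechZ_def)
qed

definition mbound :: "(nat set \<Rightarrow> nat) \<Rightarrow> nat \<Rightarrow> (nat set \<times> nat \<Rightarrow> 'k) set" where
  "mbound \<rho> i = (case i of 0 \<Rightarrow> {0} | Suc i' \<Rightarrow> mdiff \<rho> i' ` mspace \<rho> i')"

lemma subspace_mbound: "km.subspace (mbound \<rho> i)"
  unfolding mbound_def using subspace_mdiff_image by (cases i) simp_all

text \<open>If \<open>f\<close> evaluates to \<open>mdiff\<close> of some \<open>w\<close>, a lift
  \<open>y\<close> of \<open>w\<close> exists by surjectivity, and \<open>f - d i' g y\<close>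
  evaluates to zero, so it is a relation.\<close>

lemma cechB_eq: "cechB sc V act as i g = {f \<in> F i g. emap g f \<in> mbound (reg g) i}"
proof (cases i)
  case 0
  then show ?thesis by (simp add: cechB_def R_eq mbound_def)
next
  case (Suc i')
  have "x + d i' g y \<in> F i g \<and> emap g (x + d i' g y) \<in> mdiff (reg g) i' ` mspace (reg g) i'"
    if x: "x \<in> R i g" and y: "y \<in> F i' g" for x y
  proof -
    have xF: "x \<in> F i g" "emap g x = 0" using x by (auto simp: R_eq)
    have dF: "d i' g y \<in> F i g" using d_F[OF y] Suc by simp
    have "emap g (x + d i' g y) = mdiff (reg g) i' (emap g y)"
      using emap_add[OF xF(1) dF] xF(2) emap_d[OF y] by simp
    then show ?thesis using ms.subspace_add[OF subspace_F xF(1) dF] emap_mspace[OF y] by blast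
  qed
  moreover have "\<exists>x y. f = x + d i' g y \<and> x \<in> R i g \<and> y \<in> F i' g"
    if f: "f \<in> F i g" and w: "w \<in> mspace (reg g) i'" "emap g f = mdiff (reg g) i' w" for f w
  proof -
    obtain y where y: "y \<in> F i' g" "w = emap g y" using emap_surj[OF w(1)] by blast
    have dF: "d i' g y \<in> F i g" using d_F[OF y(1)] Suc by simp
    note diff = ms.subspace_diff[OF subspace_F f dF]
    have "emap g (f - d i' g y) + emap g (d i' g y) = emap g f"
      using emap_add[OF diff dF] by simp
    then have "emap g (f - d i' g y) = 0" using w(2) y(2) emap_d[OF y(1)] by simp
    then have "f - d i' g y \<in> R i g" using diff by (simp add: R_eq)
    then show ?thesis using y(1) by (intro exI[of _ "f - d i' g y"] exI[of _ y]) simp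
  qed
  ultimately show ?thesis unfolding cechB_def mbound_def Suc by fastforce
qed

lemma cech_act_Z:
  assumes gh: "h - g \<in> Gp" and f: "f \<in> cechZ sc V act as i g"
  shows "cech_act act as g h f \<in> cechZ sc V act as i h"
proof -
  have fF: "f \<in> F i g" and df: "d i g f \<in> R (Suc i) g" using f by (auto simp: cechZ_def)
  have dF: "d i g f \<in> F (Suc i) g" "emap g (d i g f) = 0" using df by (auto simp: R_eq)
  have "emap h (d i h (cech_act act as g h f)) = mact (reg g) (reg h) 0"
    unfolding d_cech_act[OF gh fF] emap_cech_act[OF gh dF(1)] dF(2) ..
  also have "\<dots> = 0" by (auto simp: mact_def cmat_0)
  finally show ?thesis
    using cech_act_F[OF gh fF] cech_act_F[OF gh dF(1)] d_cech_act[OF gh fF] by (simp add: cechZ_def R_eq)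
qed

text \<open>The new regions are the fibres of \<open>reg\<close>; \<open>emap\<close> is the map to
  the model, and the action becomes \<open>mact\<close>, which sees only the two labels.\<close>

lemma constructible_cech:
  assumes "finite (range reg)" "\<And>\<rho>. semisimple {g. reg g = \<rho>}"
  shows "constructible (fsc sc) Gp (cechZ sc V act as i) (cechB sc V act as i) (cech_act act as)"
proof (rule constructible_from_model[OF ms.vector_space_axioms km.vector_space_axioms assms])
  show "ms.subspace (F i g)" for g by (rule subspace_F)
  show "emap g (f + f') = emap g f + emap g f'" if "f \<in> F i g" "f' \<in> F i g" for g f f'
    using that by (rule emap_add)
  show "emap g (fsc sc c f) = fsc (*) c (emap g f)" if "f \<in> F i g" for g c f
    using that by (rule emap_scale)
  show "km.subspace {w \<in> mspace \<rho> i. mdiff \<rho> i w = 0}" for \<rho> by (rule subspace_cocycles)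
  show "km.subspace (mbound \<rho> i)" for \<rho> by (rule subspace_mbound)
  show "finite (mbasis \<rho> i)" for \<rho> by (rule finite_mbasis)
  show "{w \<in> mspace \<rho> i. mdiff \<rho> i w = 0} \<subseteq> km.span (mbasis \<rho> i)" for \<rho> using mspace_span by blast
  show "{w \<in> mspace (reg g) i. mdiff (reg g) i w = 0} \<subseteq> emap g ` F i g" for g using emap_surj by blast
  show "cechZ sc V act as i g = {f \<in> F i g. emap g f \<in> {w \<in> mspace (reg g) i. mdiff (reg g) i w = 0}}" for g
    by (rule cechZ_eq)
  show "cechB sc V act as i g = {f \<in> F i g. emap g f \<in> mbound (reg g) i}" for g by (rule cechB_eq)
  show "cech_act act as g h f \<in> cechZ sc V act as i h" if "h - g \<in> Gp" "f \<in> cechZ sc V act as i g" for g h f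
    using that by (rule cech_act_Z)
  show "emap h (cech_act act as g h f) = mact (reg g) (reg h) (emap g f)" if "h - g \<in> Gp" "f \<in> F i g" for g h f
    using that by (rule emap_cech_act)
qed

end

section \<open>Eventual regions\<close>

lemma definable_imp_semisimple:
  assumes "free_fin_rank TYPE('a::ab_group_add)" "definable (D :: 'a set)"
  shows "semisimple D"
  using definable_splits[OF assms(2) piecewise_UNIV[OF assms(1)]] by (auto simp: splits_def intro: piecewise_imp_semisimple)

text \<open>For each direction and region, the points that end up in that region form a definable
  set, and for a fixed direction these sets again partition the group. A fibre of \<open>reg\<close>
  is an intersection of such sets over all directions.\<close>

lemma eventual_regions:
  fixes parts :: "'a::ab_group_add set list" and dir :: "'s \<Rightarrow> 'a"
  assumes fr: "free_fin_rank TYPE('a)" and X: "finite X"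
    and ss: "\<And>I. I < length parts \<Longrightarrow> semisimple (parts ! I)"
    and part: "\<And>g. \<exists>!I. I < length parts \<and> g \<in> parts ! I"
  obtains M :: nat and reg :: "'a \<Rightarrow> 's \<Rightarrow> nat" where "M > 0" "finite (range reg)"
    "\<And>\<rho>. semisimple {g. reg g = \<rho>}"
    "\<And>g S. S \<in> X \<Longrightarrow> reg g S < length parts"
    "\<And>g S. S \<in> X \<Longrightarrow> \<forall>\<^sub>F l in sequentially. g + nmul (l * M) (dir S) \<in> parts ! reg g S"
proof -
  let ?n = "length parts"
  have definable: "definable (parts ! I)" if "I < ?n" for I
    using piecewise_imp_definable[OF fr semisimple_imp_piecewise[OF ss[OF that]]] .
  have "\<exists>m. I < ?n \<longrightarrow> m > 0 \<and> (\<forall>m'>0. m dvd m' \<longrightarrow>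
      (\<exists>P'. definable P' \<and> (\<forall>g. \<forall>\<^sub>F k in sequentially. g + nmul (k * m') (dir S) \<in> parts ! I \<longleftrightarrow> g \<in> P')))" for S I
    using definable_eventually[OF definable[of I], of "dir S"] by (cases "I < ?n") auto
  then have "\<exists>m. \<forall>S I. I < ?n \<longrightarrow> m S I > 0 \<and> (\<forall>m'>0. m S I dvd m' \<longrightarrow>
      (\<exists>P'. definable P' \<and> (\<forall>g. \<forall>\<^sub>F k in sequentially. g + nmul (k * m') (dir S) \<in> parts ! I \<longleftrightarrow> g \<in> P')))"
    by (intro choice allI)
  then obtain m where m: "\<forall>S I. I < ?n \<longrightarrow> m S I > 0 \<and> (\<forall>m'>0. m S I dvd m' \<longrightarrow>
      (\<exists>P'. definable P' \<and> (\<forall>g. \<forall>\<^sub>F k in sequentially. g + nmul (k * m') (dir S) \<in> parts ! I \<longleftrightarrow> g \<in> P')))" ..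
  \<comment> \<open>A common multiple of the finitely many periods.\<close>
  define M where "M = (\<Prod>(S, I)\<in>X \<times> {..<?n}. m S I)"
  have "m S I > 0" if "I < ?n" for S I using m that by blast
  then have M: "M > 0" unfolding M_def by (intro prod_pos) auto
  have dvd: "m S I dvd M" if "S \<in> X" "I < ?n" for S I
    unfolding M_def using dvd_prodI[of "X \<times> {..<?n}" "(S, I)" "\<lambda>(S, I). m S I"] X that by simp
  have "\<exists>P'. S \<in> X \<longrightarrow> I < ?n \<longrightarrow> definable P' \<and>
      (\<forall>g. \<forall>\<^sub>F k in sequentially. g + nmul (k * M) (dir S) \<in> parts ! I \<longleftrightarrow> g \<in> P')" for S I
    using spec[OF spec[OF m, of S], of I] M dvd[of S I] by (cases "S \<in> X \<and> I < ?n") auto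
  then have "\<exists>P'. \<forall>S I. S \<in> X \<longrightarrow> I < ?n \<longrightarrow> definable (P' S I) \<and>
      (\<forall>g. \<forall>\<^sub>F k in sequentially. g + nmul (k * M) (dir S) \<in> parts ! I \<longleftrightarrow> g \<in> P' S I)"
    by (intro choice allI)
  then obtain P' where P0: "\<forall>S I. S \<in> X \<longrightarrow> I < ?n \<longrightarrow> definable (P' S I) \<and>
      (\<forall>g. \<forall>\<^sub>F k in sequentially. g + nmul (k * M) (dir S) \<in> parts ! I \<longleftrightarrow> g \<in> P' S I)" ..
  have P'_definable: "definable (P' S I)" and P': "\<forall>\<^sub>F k in sequentially. g + nmul (k * M) (dir S) \<in> parts ! I \<longleftrightarrow> g \<in> P' S I"
    if "S \<in> X" "I < ?n" for S I g
    using spec[OF spec[OF P0, of S], of I] that by simp_all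
  have ex1: "\<exists>!I. I < ?n \<and> g \<in> P' S I" if S: "S \<in> X" for S g
  proof -
    \<comment> \<open>At one large \<open>k\<close> membership in all regions is decided
      simultaneously, so the sets \<open>P' S I\<close> inherit the partition property from
      \<open>parts\<close>.\<close>
    have "\<forall>\<^sub>F k in sequentially. \<forall>I\<in>{..<?n}. g + nmul (k * M) (dir S) \<in> parts ! I \<longleftrightarrow> g \<in> P' S I"
      using P'[OF S] by (intro eventually_ball_finite) auto
    then obtain k where "\<forall>I\<in>{..<?n}. g + nmul (k * M) (dir S) \<in> parts ! I \<longleftrightarrow> g \<in> P' S I"
      unfolding eventually_sequentially by blast
    then have "(I < ?n \<and> g \<in> P' S I) = (I < ?n \<and> g + nmul (k * M) (dir S) \<in> parts ! I)" for I by auto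
    then show ?thesis using part[of "g + nmul (k * M) (dir S)"] by simp
  qed
  \<comment> \<open>The fixed value 0 outside \<open>X\<close> leaves only finitely many functions
    as labels.\<close>
  define reg where "reg g S = (if S \<in> X then THE I. I < ?n \<and> g \<in> P' S I else 0)" for g S
  have reg: "reg g S < ?n \<and> g \<in> P' S (reg g S)" if "S \<in> X" for g S
    using theI'[OF ex1[OF that]] that by (simp add: reg_def)
  have reg_iff: "reg g S = I \<longleftrightarrow> g \<in> P' S I" if "S \<in> X" "I < ?n" for g S I
    using reg[OF that(1)] ex1[OF that(1)] that(2) by blast
  show thesis
  proof (rule that[OF M, of reg])
    show "finite (range reg)"
      by (rule finite_subset[OF _ finite_set_of_finite_funs[OF X, of "{..<?n}" 0]])
        (use reg in \<open>auto simp: reg_def\<close>)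
    show "semisimple {g. reg g = \<rho>}" for \<rho>
    proof (rule definable_imp_semisimple[OF fr])
      show "definable {g. reg g = \<rho>}"
      proof (cases "(\<forall>S. S \<notin> X \<longrightarrow> \<rho> S = 0) \<and> (\<forall>S\<in>X. \<rho> S < ?n)")
        case True
        have "reg g = \<rho> \<longleftrightarrow> (\<forall>S\<in>X. reg g S = \<rho> S)" for g
          using True by (auto simp: fun_eq_iff reg_def)
        then have "{g. reg g = \<rho>} = (\<Inter>S\<in>X. P' S (\<rho> S))" using True reg_iff by auto
        then show ?thesis using True P'_definable X by (auto intro: definable_INT)
      next
        case False
        then have "{g. reg g = \<rho>} = {}" using reg by (auto simp: reg_def)
        then show ?thesis by (simp add: definable_empty)
      qed
    qed
    show "reg g S < ?n" if "S \<in> X" for g S using reg[OF that] by blast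
    show "\<forall>\<^sub>F l in sequentially. g + nmul (l * M) (dir S) \<in> parts ! reg g S" if "S \<in> X" for g S
      using P'[OF that, of "reg g S" g] reg[OF that, of g] by simp
  qed
qed

text \<open>Since \<open>degS\<close> has zero component in \<open>Z\<close>, localizing never
  leaves a slice; the family of local cohomology modules is therefore computed degree by degree from
  the total \<open>G\<close>-graded module.\<close>

theorem theorem8p1:
  fixes sc :: "'k::field \<Rightarrow> 'v::ab_group_add \<Rightarrow> 'v"
    and Qp :: "'q::ab_group_add set"
    and Gp :: "('z::ab_group_add \<times> 'q) set"
    and V :: "'z \<times> 'q \<Rightarrow> 'v set"
    and act :: "'z \<times> 'q \<Rightarrow> 'z \<times> 'q \<Rightarrow> 'v \<Rightarrow> 'v"
    and as :: "'q list"
    and i :: nat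
  assumes "vector_space sc"
    and "presburger Qp"
    and "rees_monoid Qp Gp"
    and "gmodule sc Gp V act"
    and "constructible sc Gp V (\<lambda>_. {0}) act"
    and "set as \<subseteq> Qp"
  shows "constructible (fsc sc) Gp (cechZ sc V act as i) (cechB sc V act as i) (cech_act act as)"
proof -
  interpret vs: vector_space sc by fact
  obtain parts :: "('z \<times> 'q) set list" and r zb C where
    ss: "\<forall>P\<in>set parts. semisimple P" and
    disj: "\<forall>I J. I < length parts \<and> J < length parts \<and> I \<noteq> J \<longrightarrow> parts ! I \<inter> parts ! J = {}" and
    cover: "(\<Union>P\<in>set parts. P) = UNIV" and
    basis: "\<forall>I < length parts. \<forall>i \<in> parts ! I.
          (\<forall>s < r I. zb I i s \<in> V i) \<and>
          (\<forall>c. lincomb sc (r I) c (zb I i) \<in> {0} \<longrightarrow> (\<forall>s < r I. c s = 0)) \<and>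
          (\<forall>z \<in> V i. \<exists>c. z - lincomb sc (r I) c (zb I i) \<in> {0})" and
    maps: "\<forall>I < length parts. \<forall>J < length parts. \<forall>i \<in> parts ! I. \<forall>j \<in> parts ! J.
          j - i \<in> Gp \<longrightarrow>
          (\<forall>s < r I. act i j (zb I i s) - lincomb sc (r J) (\<lambda>t. C I J t s) (zb J j) \<in> {0})"
    using assms(5) unfolding constructible_def by (elim exE conjE)
  have part: "\<exists>!I. I < length parts \<and> g \<in> parts ! I" for g
  proof -
    have "g \<in> (\<Union>P\<in>set parts. P)" unfolding cover by simp
    then obtain I where "I < length parts" "g \<in> parts ! I" by (auto simp: in_set_conv_nth)
    then show ?thesis using disj by blast
  qed
  define reg0 where "reg0 g = (THE I. I < length parts \<and> g \<in> parts ! I)" for g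
  have reg0: "reg0 g < length parts" "g \<in> parts ! reg0 g" for g
    using theI'[OF part[of g]] by (simp_all add: reg0_def)
  have reg0_eqI: "reg0 g = I" if "I < length parts" "g \<in> parts ! I" for g I
    using part[of g] reg0[of g] that by blast
  have G: "presburger Gp" using assms(3) by (simp add: rees_monoid_def)
  \<comment> \<open>All subsets of the generators serve as directions at once, the empty one
    included, so that one period and one refinement fit every term of the complex.\<close>
  obtain M reg where M: "M > 0" and fin: "finite (range reg)" and rss: "\<And>\<rho>. semisimple {g. reg g = \<rho>}"
    and reg_lt: "\<And>g S. S \<in> Pow {..<length as} \<Longrightarrow> reg g S < length parts"
    and reg: "\<And>g S. S \<in> Pow {..<length as} \<Longrightarrow>
      \<forall>\<^sub>F l in sequentially. g + nmul (l * M) (degS as S) \<in> parts ! reg g S"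
  proof (rule eventual_regions[of "Pow {..<length as}" parts "degS as :: nat set \<Rightarrow> 'z \<times> 'q"])
    show "free_fin_rank TYPE('z \<times> 'q)" using G by (simp add: presburger_def)
  qed (use ss part in auto)
  have Qp: "0 \<in> Qp" "\<And>a b. a \<in> Qp \<Longrightarrow> b \<in> Qp \<Longrightarrow> a + b \<in> Qp" using assms(2) by (auto simp: presburger_def)
  have asQ: "as ! j \<in> Qp" if "j < length as" for j using assms(6) nth_mem[OF that] by blast
  have sumQ: "(\<Sum>j\<in>S. as ! j) \<in> Qp" if "S \<subseteq> {..<length as}" for S
    using finite_subset[OF that finite_lessThan] that
    by (induction S rule: finite_induct) (use Qp asQ in auto)
  have slice: "(0, q) \<in> Gp" if "q \<in> Qp" for q
  proof -
    have "(0, q) \<in> {g \<in> Gp. fst g = 0}" using assms(3) that by (auto simp: rees_monoid_def)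
    then show ?thesis by simp
  qed
  interpret cech_data sc Gp V act as reg0 r "\<lambda>g. zb (reg0 g) g" C M reg
  proof unfold_locales
    show "gmodule sc Gp V act" by fact
    show "0 \<in> Gp" and "\<And>a b. a \<in> Gp \<Longrightarrow> b \<in> Gp \<Longrightarrow> a + b \<in> Gp"
      using G by (auto simp: presburger_def)
    \<comment> \<open>The difference is the degree of the product over \<open>T - S\<close>; its
      second component lies in \<open>Qp\<close>, and the Rees condition places it in
      \<open>Gp\<close> at level 0.\<close>
    show "degS as T - degS as S \<in> Gp" if "S \<subseteq> T" "T \<subseteq> {..<length as}" for S T
    proof -
      have "finite T" using that finite_subset by blast
      then have "degS as T - degS as S = (0 :: 'z, \<Sum>j\<in>T - S. as ! j)"
        using sum.subset_diff[OF that(1), of "(!) as"] by (simp add: degS_def)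
      moreover have "T - S \<subseteq> {..<length as}" using that by blast
      ultimately show ?thesis using slice sumQ by simp
    qed
    show "M > 0" by fact
    show "zb (reg0 g) g s \<in> V g" if "s < r (reg0 g)" for s g
      using basis reg0 that by blast
    show "c s = 0" if "lincomb sc (r (reg0 g)) c (zb (reg0 g) g) = 0" "s < r (reg0 g)" for g c s
      using basis[rule_format, OF reg0, of g] that by simp
    show "\<exists>c. v = lincomb sc (r (reg0 g)) c (zb (reg0 g) g)" if "v \<in> V g" for v g
      using basis[rule_format, OF reg0, of g] that by simp
    show "act g h (zb (reg0 g) g s) = lincomb sc (r (reg0 h)) (\<lambda>t. C (reg0 g) (reg0 h) t s) (zb (reg0 h) h)"
      if "h - g \<in> Gp" "s < r (reg0 g)" for g h s
      using maps[rule_format, OF reg0(1)[of g] reg0(1)[of h] reg0(2)[of g] reg0(2)[of h] that] by simp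
    show "\<forall>\<^sub>F l in sequentially. reg0 (g + nmul (l * M) (degS as S)) = reg g S"
      if "S \<subseteq> {..<length as}" for S g
    proof -
      have S: "S \<in> Pow {..<length as}" using that by simp
      show ?thesis using reg[OF S, of g]
        by eventually_elim (rule reg0_eqI[OF reg_lt[OF S]])
    qed
  qed
  show ?thesis by (rule constructible_cech[OF fin rss])
qed

end
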